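(* Let $1/q$ be a prime power, $\Bbbk=\mathbb{F}_{1/q}$, $\alpha$ a weak composition of $n$, $\lambda\vdash n$, and $T$ a semistandard tableau of shape $\lambda$ and content $\alpha$. Then the number of pairs $(F,N)$ with $F\in\mathrm{Fl}_\alpha$, $N\in\mathfrak{gl}_n(\Bbbk)$ strictly compatible with $F$, and $\mathrm{JF}(N;F)=T$ equals $$\frac{q^{-n^2+n+n(\lambda)+n(\alpha)}(1-q)^{n-\lambda_1}[n]_q!}{\prod_{i\ge1}[\lambda_i-\lambda_{i+1}]_q!}\,\mathrm{wt}_q(T).$$
   Context: $n(\alpha)=\sum\binom{\alpha_i}2$; $[m]_q!=\prod_{r\le m}(1+\cdots+q^{r-1})$; $\binom{m}{r}_q=[m]_q!/([r]_q![m-r]_q!)$. $\mathrm{Fl}_\alpha$: chains $0=F_0\subseteq\cdots\subseteq F_k=\Bbbk^n$ with $\dim F_i=\alpha_1+\cdots+\alpha_i$. $N$ strictly compatible with $F$: $N(F_i)\subseteq F_{i-1}$ for $i\ge1$; then $\mathrm{JF}(N;F)$ is the semistandard tableau whose entries $\le i$ form the shape $\mathrm{JF}(N|_{F_i})$, where for nilpotent $N$, $\mathrm{JF}(N)$ is the partition with $\lambda_1+\cdots+\lambda_i=\dim\ker N^i$. $\mathrm{wt}_q(T)=\prod_{i,j\ge1}\binom{T^{(j)}_i-T^{(j)}_{i+1}}{T^{(j)}_i-T^{(j-1)}_i}_q$ with $T^{(j)}$ the shape of entries $\le j$. (Such pairs $(F,N)$ are exactly the points of a type-$A$ Nakajima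 quiver variety whose socle filtration corresponds to $T$.) *)

theory Defs
  imports "HOL-Analysis.Analysis"
begin

definition qint :: "real \<Rightarrow> nat \<Rightarrow> real" where
  "qint q r = (\<Sum>s<r. q ^ s)"

definition qfact :: "real \<Rightarrow> nat \<Rightarrow> real" where
  "qfact q m = (\<Prod>r\<in>{1..m}. qint q r)"

definition qbinom :: "real \<Rightarrow> nat \<Rightarrow> nat \<Rightarrow> real" where
  "qbinom q m r = qfact q m / (qfact q r * qfact q (m - r))"

definition nstat_list :: "nat list \<Rightarrow> nat" where
  "nstat_list \<alpha> = (\<Sum>a\<leftarrow>\<alpha>. a choose 2)"

(* partitions are functions nat => nat indexed from 1 (lambda_1, lambda_2, ...) *)
definition is_partition :: "(nat \<Rightarrow> nat) \<Rightarrow> nat \<Rightarrow> bool" where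
  "is_partition la n \<longleftrightarrow> (\<forall>i\<ge>1. la (Suc i) \<le> la i) \<and> (\<forall>i>n. la i = 0)
      \<and> (\<Sum>i=1..n. la i) = n"

definition nstat_part :: "(nat \<Rightarrow> nat) \<Rightarrow> nat \<Rightarrow> nat" where
  "nstat_part la n = (\<Sum>i=1..n. la i choose 2)"

definition weak_composition :: "nat list \<Rightarrow> nat \<Rightarrow> bool" where
  "weak_composition \<alpha> n \<longleftrightarrow> sum_list \<alpha> = n"

definition young_cells :: "(nat \<Rightarrow> nat) \<Rightarrow> (nat \<times> nat) set" where
  "young_cells la = {(r, c). 1 \<le> r \<and> 1 \<le> c \<and> c \<le> la r}"

definition semistandard :: "(nat \<times> nat \<Rightarrow> nat) \<Rightarrow> (nat \<Rightarrow> nat) \<Rightarrow> nat list \<Rightarrow> bool" where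
  "semistandard T la \<alpha> \<longleftrightarrow>
     (\<forall>p\<in>young_cells la. 1 \<le> T p \<and> T p \<le> length \<alpha>)
   \<and> (\<forall>r c. (r, c) \<in> young_cells la \<and> (r, Suc c) \<in> young_cells la \<longrightarrow> T (r, c) \<le> T (r, Suc c))
   \<and> (\<forall>r c. (r, c) \<in> young_cells la \<and> (Suc r, c) \<in> young_cells la \<longrightarrow> T (r, c) < T (Suc r, c))
   \<and> (\<forall>j\<in>{1..length \<alpha>}. card {p\<in>young_cells la. T p = j} = \<alpha> ! (j - 1))"

definition tab_shape :: "(nat \<times> nat \<Rightarrow> nat) \<Rightarrow> (nat \<Rightarrow> nat) \<Rightarrow> nat \<Rightarrow> nat \<Rightarrow> nat" where
  "tab_shape T la j i = card {c. (i, c) \<in> young_cells la \<and> T (i, c) \<le> j}"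

(* wt_q(T); factors with i > n or j > k are trivially 1 *)
definition wt :: "real \<Rightarrow> nat \<Rightarrow> (nat \<times> nat \<Rightarrow> nat) \<Rightarrow> (nat \<Rightarrow> nat) \<Rightarrow> nat list \<Rightarrow> real" where
  "wt q n T la \<alpha> = (\<Prod>i\<in>{1..n}. \<Prod>j\<in>{1..length \<alpha>}.
      qbinom q (tab_shape T la j i - tab_shape T la j (Suc i))
               (tab_shape T la j i - tab_shape T la (j - 1) i))"

definition flag_of_type :: "nat list \<Rightarrow> ('a::field ^ 'n) set list \<Rightarrow> bool" where
  "flag_of_type \<alpha> F \<longleftrightarrow> length F = Suc (length \<alpha>)
     \<and> (\<forall>i\<le>length \<alpha>. vec.subspace (F ! i) \<and> vec.dim (F ! i) = sum_list (take i \<alpha>))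
     \<and> (\<forall>i<length \<alpha>. F ! i \<subseteq> F ! Suc i)
     \<and> F ! 0 = {0} \<and> F ! length \<alpha> = UNIV"

definition strictly_compatible :: "('a::field ^ 'n ^ 'n) \<Rightarrow> ('a ^ 'n) set list \<Rightarrow> bool" where
  "strictly_compatible N F \<longleftrightarrow> (\<forall>i\<in>{1..<length F}. (\<lambda>x. N *v x) ` (F ! i) \<subseteq> F ! (i - 1))"

definition dimker :: "('a::field ^ 'n ^ 'n) \<Rightarrow> ('a ^ 'n) set \<Rightarrow> nat \<Rightarrow> nat" where
  "dimker N V j = vec.dim {x\<in>V. ((\<lambda>y. N *v y) ^^ j) x = 0}"

(* JF(N|_V): the partition mu with mu_1 + ... + mu_j = dim ker (N|_V)^j *)
definition JF :: "('a::field ^ 'n ^ 'n) \<Rightarrow> ('a ^ 'n) set \<Rightarrow> nat \<Rightarrow> nat" where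
  "JF N V r = (if r = 0 then 0 else dimker N V r - dimker N V (r - 1))"

definition JF_flag_eq :: "('a::field ^ 'n ^ 'n) \<Rightarrow> ('a ^ 'n) set list \<Rightarrow> (nat \<times> nat \<Rightarrow> nat)
     \<Rightarrow> (nat \<Rightarrow> nat) \<Rightarrow> bool" where
  "JF_flag_eq N F T la \<longleftrightarrow> (\<forall>i<length F. \<forall>r\<ge>1. tab_shape T la i r = JF N (F ! i) r)"

end

theory Submission
  imports Defs
begin

text \<open>The count is by induction on the length of the flag. Restricting \<open>N\<close> to the last proper step
  \<open>W = F\<^sub>k\<^sub>-\<^sub>1\<close> gives a pair of the same kind for the shorter flag, and it remains to count the \<open>W\<close> (a
  Gaussian binomial) and the extensions \<open>f\<close> of a fixed nilpotent \<open>g\<close> on \<open>W\<close> to a space \<open>P \<supseteq> W\<close> with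
  \<open>f P \<subseteq> W\<close> and prescribed Jordan type \<open>\<lambda>\<close>. If \<open>g\<close> has type \<open>\<mu>\<close>, put \<open>U\<^sub>i = g W + ker g\<^sup>i\<close>, a chain of
  subspaces of codimension \<open>\<mu>\<^sub>i\<^sub>+\<^sub>1\<close> in \<open>W\<close>. Then \<open>f\<close> has type \<open>\<lambda>\<close> if and only if the preimage of
  \<open>U\<^sub>i\<close> in \<open>P\<close> has dimension \<open>dim W + (\<lambda>\<^sub>1 - \<mu>\<^sub>1) + \<dots> + (\<lambda>\<^sub>i\<^sub>+\<^sub>1 - \<mu>\<^sub>i\<^sub>+\<^sub>1)\<close> for all \<open>i\<close>. Such maps are counted by
  choosing the preimages from the top of the chain downwards and extending \<open>f\<close> back one step at a
  time, injectively modulo the previous step. The resulting product of Gaussian binomials and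
  numbers of injections is the ratio of two consecutive values of the claimed formula.\<close>

section \<open>Extending linear maps over a finite field\<close>

lemma span_insert_subspace:
  assumes "vec.subspace P"
  shows "x \<in> vec.span (insert v P) \<longleftrightarrow> (\<exists>k. x - k *s v \<in> P)"
  using assms by (metis vec.span_breakdown_eq vec.span_eq_iff)

lemma span_insert_coeff_unique:
  assumes P: "vec.subspace P" and v: "v \<notin> P"
    and k: "x - k *s v \<in> P" and l: "x - l *s v \<in> P"
  shows "k = (l::'a::field)"
proof (rule ccontr)
  assume "k \<noteq> l"
  have "(x - k *s v) - (x - l *s v) \<in> P"
    using P k l by (rule vec.subspace_diff)
  then have "(l - k) *s v \<in> P"
    by (simp add: vec.scale_left_diff_distrib)
  then have "inverse (l - k) *s ((l - k) *s v) \<in> P"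
    using P by (rule vec.subspace_scale[rotated])
  moreover have "inverse (l - k) *s ((l - k) *s v) = v"
    using \<open>k \<noteq> l\<close> by (simp only: vec.scale_scale) simp
  ultimately show False
    using v by simp
qed

lemma span_insert_least:
  assumes "vec.subspace P" "W \<subseteq> P" "v \<in> P"
  shows "vec.span (insert v W) \<subseteq> P"
  using assms by (intro vec.span_minimal) auto

lemma subset_span_insert: "W \<subseteq> vec.span (insert v W)" "v \<in> vec.span (insert v W)"
  by (auto intro: vec.span_base)

lemma dim_span_insert:
  assumes "vec.subspace W" "v \<notin> W"
  shows "vec.dim (vec.span (insert v W)) = Suc (vec.dim W)"
  using assms by (simp add: vec.dim_insert vec.span_eq_iff[THEN iffD2])

lemma card_span_insert:
  fixes P :: "('a::{field,finite} ^ 'n) set"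
  assumes P: "vec.subspace P" and v: "v \<notin> P"
  shows "card (vec.span (insert v P)) = CARD('a) * card P"
proof -
  have "bij_betw (\<lambda>(k, x). x + k *s v) (UNIV \<times> P) (vec.span (insert v P))"
  proof (rule bij_betw_imageI)
    show "inj_on (\<lambda>(k, x). x + k *s v) (UNIV \<times> P)"
    proof (rule inj_onI, clarify)
      fix k x l y assume xy: "x \<in> P" "y \<in> P" and eq: "x + k *s v = y + l *s v"
      have "k = l"
        by (rule span_insert_coeff_unique[OF P v, of "x + k *s v"]) (use xy in \<open>simp_all add: eq[symmetric]\<close>, simp add: eq)
      with eq show "k = l \<and> x = y" by simp
    qed
    show "(\<lambda>(k, x). x + k *s v) ` (UNIV \<times> P) = vec.span (insert v P)"
    proof (intro equalityI subsetI)
      fix x assume "x \<in> vec.span (insert v P)"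
      then obtain k where "x - k *s v \<in> P"
        using span_insert_subspace[OF P] by blast
      then show "x \<in> (\<lambda>(k, x). x + k *s v) ` (UNIV \<times> P)"
        by (intro image_eqI[of _ _ "(k, x - k *s v)"]) auto
    next
      fix y assume "y \<in> (\<lambda>(k, x). x + k *s v) ` (UNIV \<times> P)"
      then obtain k x where "x \<in> P" "y = x + k *s v" by auto
      then show "y \<in> vec.span (insert v P)"
        unfolding span_insert_subspace[OF P] by (intro exI[of _ k]) simp
    qed
  qed
  then show ?thesis
    by (metis bij_betw_same_card card_cartesian_product)
qed

lemma card_subspace:
  fixes P :: "('a::{field,finite} ^ 'n) set"
  assumes "vec.subspace P"
  shows "card P = CARD('a) ^ vec.dim P"
proof -
  have "card (vec.span B) = CARD('a) ^ card B"
    if "finite B" "vec.independent B" for B :: "('a ^ 'n) set"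
    using that
  proof (induction B rule: finite_induct)
    case (insert v B)
    then have "v \<notin> vec.span B" and "vec.independent B"
      using vec.independent_insert[of v B] by (simp_all split: if_splits)
    moreover have "vec.span (insert v B) = vec.span (insert v (vec.span B))"
      by (simp add: set_eq_iff vec.span_breakdown_eq vec.span_span)
    ultimately show ?case
      using card_span_insert[of "vec.span B" v] insert.hyps insert.IH by simp
  qed simp
  moreover obtain B where B: "B \<subseteq> P" "vec.independent B" "P \<subseteq> vec.span B" "card B = vec.dim P"
    using vec.basis_exists by blast
  moreover have "vec.span B = P"
    using B assms by (intro vec.span_subspace)
  ultimately show ?thesis
    by (metis finite)
qed

lemma card_scalars_ge_2: "CARD('a::{field,finite}) \<ge> 2"
proof -
  have "card {0::'a, 1} \<le> CARD('a)" by (rule card_mono) auto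
  then show ?thesis by simp
qed

lemma subspace_eqI_dim:
  assumes "vec.subspace S" "vec.subspace T" "S \<subseteq> T" "vec.dim S = vec.dim T"
  shows "S = T"
  using vec.subspace_dim_equal[of S T] assms by simp

lemma exists_outside:
  assumes "vec.subspace W" "vec.subspace P" "W \<subseteq> P" "vec.dim W < vec.dim P"
  obtains v where "v \<in> P" "v \<notin> W"
  using assms by (metis less_irrefl subset_antisym subsetI)

text \<open>The counts below are organised as chains of fibrations with fibres of constant size. The
  constant lives in a semiring so that it may be a real expression with differences and quotients;
  fibres may be empty, with \<open>c\<close> equal to zero.\<close>

lemma of_nat_card_eq_fibres:
  fixes c :: "'c::semiring_1"
  assumes A: "finite A" and B: "finite B" and f: "\<And>a. a \<in> A \<Longrightarrow> f a \<in> B"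
    and c: "\<And>b. b \<in> B \<Longrightarrow> of_nat (card {a \<in> A. f a = b}) = c"
  shows "of_nat (card A) = of_nat (card B) * c"
proof -
  have "card A = (\<Sum>b\<in>B. card {a \<in> A. f a = b})"
    using sum.group[OF A B, of f "\<lambda>_. 1::nat"] f by (simp add: image_subset_iff)
  then show ?thesis using c by simp
qed

lemmas card_eq_fibres = of_nat_card_eq_fibres[where 'c = nat, simplified]

section \<open>Linear maps given on a subspace only\<close>

definition linear_on :: "('a::field ^ 'n) set \<Rightarrow> ('a ^ 'n \<Rightarrow> 'a ^ 'n) \<Rightarrow> bool" where
  "linear_on P f \<longleftrightarrow> (\<forall>x\<in>P. \<forall>y\<in>P. f (x + y) = f x + f y) \<and> (\<forall>c. \<forall>x\<in>P. f (c *s x) = c *s f x)"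

text \<open>A linear map defined on a subspace \<open>P\<close> is represented by its extension by zero outside
  \<open>P\<close> (which is not linear), so that it is determined by its values on \<open>P\<close>.\<close>

definition Lin :: "('a::field ^ 'n) set \<Rightarrow> ('a ^ 'n) set \<Rightarrow> ('a ^ 'n \<Rightarrow> 'a ^ 'n) set" where
  "Lin P U = {f. linear_on P f \<and> f ` P \<subseteq> U \<and> (\<forall>x. x \<notin> P \<longrightarrow> f x = 0)}"

definition restr :: "('a::field ^ 'n) set \<Rightarrow> ('a ^ 'n \<Rightarrow> 'a ^ 'n) \<Rightarrow> 'a ^ 'n \<Rightarrow> 'a ^ 'n" where
  "restr P f = (\<lambda>x. if x \<in> P then f x else 0)"

lemma linear_onD:
  assumes "linear_on P f"
  shows "x \<in> P \<Longrightarrow> y \<in> P \<Longrightarrow> f (x + y) = f x + f y" "x \<in> P \<Longrightarrow> f (c *s x) = c *s f x"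
  using assms unfolding linear_on_def by auto

lemma linear_on_0:
  assumes "linear_on P f" "vec.subspace P"
  shows "f 0 = 0"
  using linear_onD(2)[OF assms(1), of 0 0] vec.subspace_0[OF assms(2)] by simp

lemma linear_on_diff:
  assumes f: "linear_on P f" and P: "vec.subspace P" and "x \<in> P" "y \<in> P"
  shows "f (x - y) = f x - f y"
proof -
  have "x - y \<in> P" by (rule vec.subspace_diff[OF P assms(3,4)])
  then have "f (x - y + y) = f (x - y) + f y"
    using linear_onD(1)[OF f] assms(4) by blast
  then show ?thesis by simp
qed

lemma linear_on_subset: "linear_on P f \<Longrightarrow> W \<subseteq> P \<Longrightarrow> linear_on W f"
  unfolding linear_on_def by blast

lemma LinD:
  assumes "f \<in> Lin P U"
  shows "linear_on P f" "x \<in> P \<Longrightarrow> f x \<in> U" "x \<notin> P \<Longrightarrow> f x = 0"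
  using assms unfolding Lin_def by auto

lemma restr_Lin:
  assumes "f \<in> Lin P U" "vec.subspace W" "W \<subseteq> P" "f ` W \<subseteq> U'"
  shows "restr W f \<in> Lin W U'"
proof -
  have "linear_on W (restr W f)"
    using linear_on_subset[OF LinD(1)[OF assms(1)] assms(3)] assms(2)
    by (auto simp: linear_on_def restr_def vec.subspace_add vec.subspace_scale)
  then show ?thesis using assms(4) by (auto simp: Lin_def restr_def)
qed

lemma restr_restr: "W \<subseteq> P \<Longrightarrow> restr W (restr P f) = restr W f"
  by (auto simp: restr_def fun_eq_iff)

lemma restr_eqD: "restr W f = g \<Longrightarrow> x \<in> W \<Longrightarrow> f x = g x"
  by (auto simp: restr_def)

lemma restr_eqI: "(\<And>x. x \<in> W \<Longrightarrow> f x = g x) \<Longrightarrow> g \<in> Lin W U \<Longrightarrow> restr W f = g"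
  by (auto simp: restr_def fun_eq_iff dest: LinD(3))

lemma restr_self: "f \<in> Lin P U \<Longrightarrow> restr P f = f"
  by (auto intro: restr_eqI)

lemma subspace_preimage:
  assumes "linear_on P f" "vec.subspace P" "vec.subspace U"
  shows "vec.subspace {x \<in> P. f x \<in> U}"
proof (rule vec.subspaceI)
  show "0 \<in> {x \<in> P. f x \<in> U}"
    using assms by (simp add: linear_on_0 vec.subspace_0)
  show "x + y \<in> {x \<in> P. f x \<in> U}" if "x \<in> {x \<in> P. f x \<in> U}" "y \<in> {x \<in> P. f x \<in> U}" for x y
    using that assms linear_onD(1)[OF assms(1), of x y] by (simp add: vec.subspace_add)
  show "c *s x \<in> {x \<in> P. f x \<in> U}" if "x \<in> {x \<in> P. f x \<in> U}" for c x
    using that assms linear_onD(2)[OF assms(1), of x c] by (simp add: vec.subspace_scale)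
qed

lemma subspace_linear_image:
  assumes "linear_on P f" "vec.subspace P"
  shows "vec.subspace (f ` P)"
  unfolding vec.subspace_def
proof (intro conjI ballI allI)
  show "0 \<in> f ` P"
    using linear_on_0[OF assms] vec.subspace_0[OF assms(2)] by (metis imageI)
next
  fix u w assume "u \<in> f ` P" "w \<in> f ` P"
  then obtain x y where "x \<in> P" "u = f x" "y \<in> P" "w = f y" by blast
  then show "u + w \<in> f ` P"
    using linear_onD(1)[OF assms(1), of x y] vec.subspace_add[OF assms(2), of x y]
    by (intro image_eqI[of _ _ "x + y"]) auto
next
  fix c u assume "u \<in> f ` P"
  then obtain x where "x \<in> P" "u = f x" by blast
  then show "c *s u \<in> f ` P"
    using linear_onD(2)[OF assms(1), of x c] vec.subspace_scale[OF assms(2), of x c]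
    by (intro image_eqI[of _ _ "c *s x"]) auto
qed

text \<open>The nonempty fibres of \<open>f\<close> on \<open>P\<close> are translates of the
  kernel, so the cardinality of \<open>P\<close> is that of the image times that of the kernel;
  comparing exponents of the field size gives the dimensions.\<close>

lemma rank_nullity_on:
  fixes f :: "'a::{field,finite} ^ 'n \<Rightarrow> 'a ^ 'n"
  assumes f: "linear_on P f" and P: "vec.subspace P"
  shows "vec.dim P = vec.dim (f ` P) + vec.dim {x \<in> P. f x = 0}"
proof -
  let ?K = "{x \<in> P. f x = 0}"
  have K: "vec.subspace ?K"
    using subspace_preimage[OF f P, of "{0}"] by simp
  have "card P = card (f ` P) * card ?K"
  proof (rule card_eq_fibres)
    fix b assume "b \<in> f ` P"
    then obtain y where y: "y \<in> P" "b = f y" by blast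
    have "bij_betw (\<lambda>x. x + y) ?K {a \<in> P. f a = b}"
    proof (rule bij_betw_byWitness[where f' = "\<lambda>x. x - y"])
      show "(\<lambda>x. x + y) ` ?K \<subseteq> {a \<in> P. f a = b}"
        using y linear_onD(1)[OF f] vec.subspace_add[OF P] by auto
      show "(\<lambda>x. x - y) ` {a \<in> P. f a = b} \<subseteq> ?K"
        using y linear_on_diff[OF f P] vec.subspace_diff[OF P] by auto
    qed auto
    then show "card {a \<in> P. f a = b} = card ?K"
      by (rule bij_betw_same_card[symmetric])
  qed simp_all
  then have "CARD('a) ^ vec.dim P = CARD('a) ^ (vec.dim (f ` P) + vec.dim ?K)"
    unfolding card_subspace[OF P] card_subspace[OF K]
      card_subspace[OF subspace_linear_image[OF f P]] power_add .
  moreover have "1 < CARD('a)"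
    using card_scalars_ge_2[where 'a='a] by linarith
  ultimately show ?thesis
    using power_inject_exp by blast
qed

text \<open>Evaluation at \<open>v\<close> is a bijection: an extension is determined by its value
  at \<open>v\<close>, and every value in \<open>U\<close> occurs. The set \<open>X\<close> of
  allowed values stays general, since it will be both all of \<open>U\<close> and a difference of
  two subspaces.\<close>

lemma Lin_extend_by_vector:
  fixes P :: "('a::{field,finite} ^ 'n) set"
  assumes P: "vec.subspace P" and U: "vec.subspace U" and v: "v \<notin> P"
    and g: "g \<in> Lin P U" and X: "X \<subseteq> U"
  shows "card {f \<in> Lin (vec.span (insert v P)) U. restr P f = g \<and> f v \<in> X} = card X"
proof -
  let ?S = "vec.span (insert v P)"
  let ?A = "{f \<in> Lin ?S U. restr P f = g \<and> f v \<in> X}"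
  note iff = span_insert_subspace[OF P]
  have PS: "P \<subseteq> ?S" and vS: "v \<in> ?S" by (auto intro: vec.span_base)
  have decomp: "f x = g (x - k *s v) + k *s f v" if "f \<in> ?A" "x - k *s v \<in> P" for f x k
  proof -
    have "f ((x - k *s v) + k *s v) = f (x - k *s v) + f (k *s v)"
      by (intro linear_onD(1)[OF LinD(1)[of f ?S U]])
        (use that PS vS in \<open>auto intro: vec.span_scale\<close>)
    moreover have "f (k *s v) = k *s f v"
      by (intro linear_onD(2)[OF LinD(1)[of f ?S U]]) (use that vS in auto)
    moreover have "f (x - k *s v) = g (x - k *s v)"
      using that by (auto intro: restr_eqD)
    ultimately show ?thesis by simp
  qed
  have "bij_betw (\<lambda>f. f v) ?A X"
  proof (rule bij_betw_imageI)
    show "inj_on (\<lambda>f. f v) ?A"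
    proof (rule inj_onI, rule ext)
      fix f f' x assume f: "f \<in> ?A" "f' \<in> ?A" "f v = f' v"
      show "f x = f' x"
      proof (cases "x \<in> ?S")
        case True
        then obtain k where "x - k *s v \<in> P" using iff by blast
        then show ?thesis using decomp[OF f(1)] decomp[OF f(2)] f(3) by simp
      next
        case False
        then show ?thesis using f LinD(3) by (metis (no_types, lifting) mem_Collect_eq)
      qed
    qed
    show "(\<lambda>f. f v) ` ?A = X"
    proof (intro equalityI subsetI)
      fix w assume w: "w \<in> X"
      \<comment> \<open>\<open>\<kappa> x\<close> is the coefficient of \<open>v\<close> in
        \<open>x\<close>, well defined on the span because \<open>v\<close> lies outside
        \<open>P\<close>. It turns the only possible formula for an extension with value
        \<open>w\<close> at \<open>v\<close> into a definition.\<close>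
      define \<kappa> where "\<kappa> x = (THE k. x - k *s v \<in> P)" for x
      have \<kappa>: "\<kappa> x = k" if "x - k *s v \<in> P" for x k
        unfolding \<kappa>_def by (rule the_equality) (use that span_insert_coeff_unique[OF P v] in auto)
      have \<kappa>P: "x - \<kappa> x *s v \<in> P" if "x \<in> ?S" for x
        using that iff \<kappa> by blast
      define f where "f x = (if x \<in> ?S then g (x - \<kappa> x *s v) + \<kappa> x *s w else 0)" for x
      have k0: "\<kappa> x = 0" if "x \<in> P" for x
        using \<kappa>[of x 0] that by simp
      have kv: "\<kappa> v = 1"
        using \<kappa>[of v 1] vec.subspace_0[OF P] by simp
      have "linear_on ?S f"
        unfolding linear_on_def
      proof (intro conjI ballI allI)
        fix x y assume xy: "x \<in> ?S" "y \<in> ?S"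
        have *: "x + y - (\<kappa> x + \<kappa> y) *s v = (x - \<kappa> x *s v) + (y - \<kappa> y *s v)"
          by (simp add: vec.scale_left_distrib)
        have "\<kappa> (x + y) = \<kappa> x + \<kappa> y"
          by (rule \<kappa>) (unfold *, use \<kappa>P[OF xy(1)] \<kappa>P[OF xy(2)] vec.subspace_add[OF P] in blast)
        then show "f (x + y) = f x + f y"
          using xy linear_onD(1)[OF LinD(1)[OF g] \<kappa>P[OF xy(1)] \<kappa>P[OF xy(2)], folded *]
          by (simp add: f_def vec.span_add vec.scale_left_distrib)
      next
        fix c x assume x: "x \<in> ?S"
        have *: "c *s x - (c * \<kappa> x) *s v = c *s (x - \<kappa> x *s v)"
          by (simp add: vec.scale_right_diff_distrib)
        have "\<kappa> (c *s x) = c * \<kappa> x"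
          by (rule \<kappa>) (unfold *, use \<kappa>P[OF x] vec.subspace_scale[OF P] in blast)
        then show "f (c *s x) = c *s f x"
          using x linear_onD(2)[OF LinD(1)[OF g] \<kappa>P[OF x], of c, folded *]
          by (simp add: f_def vec.span_scale vec.scale_right_distrib)
      qed
      moreover have "f x \<in> U" if "x \<in> ?S" for x
        using that w X LinD(2)[OF g \<kappa>P[OF that]] U
        by (auto simp: f_def intro!: vec.subspace_add vec.subspace_scale)
      moreover have "restr P f = g"
        by (rule restr_eqI[OF _ g]) (use PS k0 in \<open>auto simp: f_def\<close>)
      moreover have "f v = w"
        using vS kv linear_on_0[OF LinD(1)[OF g] P] by (simp add: f_def)
      ultimately show "w \<in> (\<lambda>f. f v) ` ?A"
        using w by (intro image_eqI[of _ _ f]) (auto simp: Lin_def f_def)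
    qed auto
  qed
  then show ?thesis by (rule bij_betw_same_card)
qed

text \<open>Vectors completing \<open>W\<close> to \<open>P\<close> are adjoined one at a time, and
  each contributes one free choice in \<open>U\<close>.\<close>

lemma card_Lin_extensions:
  fixes P :: "('a::{field,finite} ^ 'n) set"
  assumes "vec.subspace W" "vec.subspace P" "W \<subseteq> P" "vec.subspace U" "g \<in> Lin W U"
  shows "card {f \<in> Lin P U. restr W f = g} = card U ^ (vec.dim P - vec.dim W)"
  using assms
proof (induction "vec.dim P - vec.dim W" arbitrary: W g)
  case 0
  then have "W = P"
    using vec.dim_subset[of W P] by (intro subspace_eqI_dim) auto
  then have "{f \<in> Lin P U. restr W f = g} = {g}"
    using 0 by (auto simp: restr_self)
  then show ?case using 0 by simp
next
  case (Suc d)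
  then obtain v where v: "v \<in> P" "v \<notin> W"
    using exists_outside[OF Suc.prems(1,2,3)] by (metis zero_less_Suc zero_less_diff)
  let ?W = "vec.span (insert v W)"
  let ?B = "{h \<in> Lin ?W U. restr W h = g \<and> h v \<in> U}"
  have WP: "?W \<subseteq> P"
    by (rule span_insert_least) (use Suc v in auto)
  have WW: "W \<subseteq> ?W" by (rule subset_span_insert)
  have d: "d = vec.dim P - vec.dim ?W"
    using Suc.hyps(2) dim_span_insert[OF Suc.prems(1) v(2)] by linarith
  have "card {f \<in> Lin P U. restr W f = g} = card ?B * card U ^ d"
  proof (rule card_eq_fibres[where f = "restr ?W"])
    fix f assume "f \<in> {f \<in> Lin P U. restr W f = g}"
    moreover from this have "restr ?W f \<in> Lin ?W U"
      using WP by (intro restr_Lin[of f P U]) (auto dest: LinD(2))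
    ultimately show "restr ?W f \<in> ?B"
      using restr_restr[OF WW] LinD(2)[OF _ subset_span_insert(2)] by auto
  next
    fix h assume h: "h \<in> ?B"
    have "{f \<in> {f \<in> Lin P U. restr W f = g}. restr ?W f = h} = {f \<in> Lin P U. restr ?W f = h}"
      using h restr_restr[OF WW] by auto
    then show "card {f \<in> {f \<in> Lin P U. restr W f = g}. restr ?W f = h} = card U ^ d"
      using Suc.hyps(1)[OF d, of h] d h WP Suc.prems by simp
  qed auto
  moreover have "card ?B = card U"
    by (rule Lin_extend_by_vector) (use Suc v in auto)
  ultimately show ?case
    using Suc.hyps(2) by (metis power_Suc)
qed

text \<open>Since \<open>f v\<close> is outside \<open>U\<close> and \<open>f\<close> sends
  \<open>X\<close> into \<open>U\<close>, the coefficient of \<open>v\<close> modulo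
  \<open>X\<close> agrees with that of \<open>f v\<close> modulo \<open>U\<close>. So
  \<open>X\<close> and \<open>U\<close> can be enlarged together without changing the condition on
  preimages, which drives the induction in the following count.\<close>

lemma preimage_span_insert_iff:
  assumes P: "vec.subspace P" and U: "vec.subspace U" and X: "vec.subspace X"
    and XP: "X \<subseteq> P" and f: "linear_on P f" and v: "v \<in> P" "v \<notin> X"
    and fX: "f ` X \<subseteq> U" and fv: "f v \<notin> U"
  shows "{y \<in> P. f y \<in> U} = X \<longleftrightarrow>
    {y \<in> P. f y \<in> vec.span (insert (f v) U)} = vec.span (insert v X)"
proof -
  have fdiff: "f (y - k *s v) = f y - k *s f v" if "y \<in> P" for y k
    using that v P linear_on_diff[OF f P that, of "k *s v"] linear_onD(2)[OF f v(1)]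
    by (simp add: vec.subspace_scale)
  have sub: "y - k *s v \<in> P" if "y \<in> P" for y k
    using that v P by (simp add: vec.subspace_diff vec.subspace_scale)
  have yP: "y \<in> P" if "y - k *s v \<in> X" for y k
  proof -
    have "(y - k *s v) + k *s v \<in> P"
      using that XP v P by (intro vec.subspace_add vec.subspace_scale) auto
    then show ?thesis by simp
  qed
  show ?thesis
  proof
    assume eq: "{y \<in> P. f y \<in> U} = X"
    have "y \<in> P \<and> f y - k *s f v \<in> U \<longleftrightarrow> y - k *s v \<in> X" for y k
      using eq fdiff[of y k] sub[of y k] yP[of y k] by auto
    then show "{y \<in> P. f y \<in> vec.span (insert (f v) U)} = vec.span (insert v X)"
      unfolding set_eq_iff span_insert_subspace[OF U] span_insert_subspace[OF X] by auto
  next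
    assume eq: "{y \<in> P. f y \<in> vec.span (insert (f v) U)} = vec.span (insert v X)"
    show "{y \<in> P. f y \<in> U} = X"
    proof (intro equalityI subsetI)
      fix y assume y: "y \<in> {y \<in> P. f y \<in> U}"
      then have "y \<in> vec.span (insert v X)"
        using eq vec.span_base[of "f y" "insert (f v) U"] by auto
      then obtain k where k: "y - k *s v \<in> X"
        using span_insert_subspace[OF X] by blast
      then have "f y - k *s f v \<in> U"
        using fX fdiff[of y k] y by auto
      then have "k = 0"
        using span_insert_coeff_unique[OF U fv, of "f y" k 0] y by simp
      then show "y \<in> X" using k by simp
    qed (use XP fX in auto)
  qed
qed

text \<open>The preimage condition says that the induced map from \<open>P / X\<close> to
  \<open>U' / U\<close> is injective. Images of successive basis vectors must avoid \<open>U\<close>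
  together with the earlier images, which gives the factors; if \<open>U'\<close> is too small, one
  of them vanishes.\<close>

lemma card_Lin_extensions_preimage:
  fixes P :: "('a::{field,finite} ^ 'n) set"
  assumes "vec.subspace X" "vec.subspace P" "X \<subseteq> P" "vec.subspace U" "vec.subspace U'" "U \<subseteq> U'"
    and "h \<in> Lin X U"
  shows "real (card {f \<in> Lin P U'. restr X f = h \<and> {y \<in> P. f y \<in> U} = X})
    = (\<Prod>t<vec.dim P - vec.dim X. real CARD('a) ^ vec.dim U' - real CARD('a) ^ (vec.dim U + t))"
  using assms
proof (induction "vec.dim P - vec.dim X" arbitrary: X U h)
  case 0
  then have "X = P"
    using vec.dim_subset[of X P] by (intro subspace_eqI_dim) auto
  moreover have "h \<in> Lin X U'"
    using 0 by (auto simp: Lin_def)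
  ultimately have "{f \<in> Lin P U'. restr X f = h \<and> {y \<in> P. f y \<in> U} = X} = {h}"
    using 0 by (auto simp: restr_self dest: LinD(2))
  then show ?case using 0 by simp
next
  case (Suc d)
  then obtain v where v: "v \<in> P" "v \<notin> X"
    using exists_outside[OF Suc.prems(1,2,3)] by (metis zero_less_Suc zero_less_diff)
  let ?Q = "real CARD('a)"
  let ?X = "vec.span (insert v X)"
  let ?A = "{f \<in> Lin P U'. restr X f = h \<and> {y \<in> P. f y \<in> U} = X}"
  let ?B = "{h1 \<in> Lin ?X U'. restr X h1 = h \<and> h1 v \<in> U' - U}"
  \<comment> \<open>The count for the enlarged pair: the dimension of \<open>U\<close> has gone up
    by one, so the factor for \<open>t = 0\<close> has been removed.\<close>
  define c where "c = (\<Prod>t<d. ?Q ^ vec.dim U' - ?Q ^ (Suc (vec.dim U) + t))"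
  have XP: "?X \<subseteq> P"
    by (rule span_insert_least) (use Suc v in auto)
  have XX: "X \<subseteq> ?X" "v \<in> ?X" by (rule subset_span_insert)+
  have hU': "h \<in> Lin X U'"
    using Suc.prems by (auto simp: Lin_def)
  have d: "d = vec.dim P - vec.dim ?X"
    using Suc.hyps(2) dim_span_insert[OF Suc.prems(1) v(2)] by linarith
  have fib: "real (card {f \<in> ?A. restr ?X f = h1}) = c" if h1: "h1 \<in> ?B" for h1
  proof -
    let ?U = "vec.span (insert (h1 v) U)"
    have dU: "vec.dim ?U = Suc (vec.dim U)"
      by (rule dim_span_insert) (use h1 Suc.prems in auto)
    have UU: "?U \<subseteq> U'"
      by (rule span_insert_least) (use h1 Suc.prems in auto)
    have h1U: "h1 \<in> Lin ?X ?U"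
    proof -
      have "h1 y \<in> ?U" if "y \<in> ?X" for y
      proof -
        obtain k where k: "y - k *s v \<in> X"
          using \<open>y \<in> ?X\<close> span_insert_subspace[OF Suc.prems(1)] by blast
        have "h1 (y - k *s v) = h1 y - h1 (k *s v)"
          by (rule linear_on_diff[of ?X]) (use h1 that XX in \<open>auto dest: LinD(1) intro: vec.span_scale\<close>)
        also have "h1 (k *s v) = k *s h1 v"
          using h1 XX linear_onD(2)[OF LinD(1)] by blast
        finally have "h1 y - k *s h1 v = h (y - k *s v)"
          using h1 k restr_eqD[of X h1 h] by simp
        then show ?thesis
          using span_insert_subspace[OF Suc.prems(4)] LinD(2)[OF Suc.prems(7) k] by metis
      qed
      then show ?thesis using h1 by (auto simp: Lin_def)
    qed
    have "{f \<in> ?A. restr ?X f = h1} = {f \<in> Lin P U'. restr ?X f = h1 \<and> {y \<in> P. f y \<in> ?U} = ?X}"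
    proof -
      have "restr X f = h \<and> ({y \<in> P. f y \<in> U} = X \<longleftrightarrow> {y \<in> P. f y \<in> ?U} = ?X)"
        if f: "f \<in> Lin P U'" "restr ?X f = h1" for f
      proof -
        have rX: "restr X f = h"
          using h1 f restr_restr[OF XX(1)] by auto
        have fv: "f v = h1 v"
          using f(2) XX(2) restr_eqD by blast
        have "{y \<in> P. f y \<in> U} = X \<longleftrightarrow> {y \<in> P. f y \<in> vec.span (insert (f v) U)} = ?X"
        proof (rule preimage_span_insert_iff)
          show "f ` X \<subseteq> U" using rX Suc.prems(7) restr_eqD[of X f h] by (auto dest: LinD(2))
          show "f v \<notin> U" using fv h1 by simp
        qed (use Suc.prems f v in \<open>auto dest: LinD(1)\<close>)
        then show ?thesis using rX fv by simp
      qed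
      then show ?thesis by blast
    qed
    then show ?thesis
      using Suc.hyps(1)[OF d, of ?U h1] d dU h1U XP UU Suc.prems unfolding c_def
      by simp
  qed
  have "real (card ?A) = real (card ?B) * c"
  proof (rule of_nat_card_eq_fibres[OF _ _ _ fib])
    fix f assume f: "f \<in> ?A"
    have "restr ?X f \<in> Lin ?X U'"
      using f XP by (intro restr_Lin[of f P U']) (auto dest: LinD(2))
    moreover have "f v \<in> U' - U"
      using f v by (auto dest: LinD(2))
    ultimately show "restr ?X f \<in> ?B"
      using f restr_restr[OF XX(1)] XX(2) by (auto simp: restr_def)
  qed auto
  also have "card ?B = card (U' - U)"
    by (rule Lin_extend_by_vector) (use Suc v hU' in auto)
  also have "real (card (U' - U)) = ?Q ^ vec.dim U' - ?Q ^ vec.dim U"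
    using Suc.prems card_mono[of U' U] by (simp add: card_Diff_subset card_subspace of_nat_diff)
  finally show ?case
    unfolding Suc.hyps(2)[symmetric] c_def prod.lessThan_Suc_shift by simp
qed

section \<open>Maps with prescribed preimage dimensions\<close>

text \<open>The number of \<open>d\<close>-dimensional subspaces of a \<open>D\<close>-dimensional
  space over a field with \<open>Q\<close> elements. The parameter is the field size, whereas
  \<open>qbinom\<close> is used at its inverse. For \<open>d > D\<close> the numerator at
  \<open>t = D\<close> is zero, as it should be.\<close>

definition gauss_binom :: "real \<Rightarrow> nat \<Rightarrow> nat \<Rightarrow> real" where
  "gauss_binom Q D d = (\<Prod>t<d. (Q ^ (D - t) - 1) / (Q ^ (d - t) - 1))"

lemma gauss_binom_Suc:
  "gauss_binom Q D (Suc d) = (Q ^ D - 1) / (Q ^ Suc d - 1) * gauss_binom Q (D - 1) d"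
  unfolding gauss_binom_def prod.lessThan_Suc_shift by simp

text \<open>Pairs of a subspace \<open>X\<close> and a vector \<open>v\<close> in
  \<open>X - W\<close> are counted in two ways. For fixed \<open>X\<close> the number of
  \<open>v\<close> is a difference of powers; for fixed \<open>v\<close> the \<open>X\<close> are
  those above the span of \<open>W\<close> and \<open>v\<close>, counted by induction.\<close>

lemma card_intermediate_subspaces:
  fixes P :: "('a::{field,finite} ^ 'n) set"
  assumes "vec.subspace W" "vec.subspace P" "W \<subseteq> P"
  shows "real (card {X. vec.subspace X \<and> W \<subseteq> X \<and> X \<subseteq> P \<and> vec.dim X = vec.dim W + d})
    = gauss_binom (real CARD('a)) (vec.dim P - vec.dim W) d"
  using assms
proof (induction d arbitrary: W)
  case 0
  have "{X. vec.subspace X \<and> W \<subseteq> X \<and> X \<subseteq> P \<and> vec.dim X = vec.dim W + 0} = {W}"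
    using 0 by (auto dest: subspace_eqI_dim[of W])
  then show ?case by (simp add: gauss_binom_def)
next
  case (Suc d)
  let ?Q = "real CARD('a)"
  let ?G = "{X. vec.subspace X \<and> W \<subseteq> X \<and> X \<subseteq> P \<and> vec.dim X = vec.dim W + Suc d}"
  let ?A = "{(v, X). X \<in> ?G \<and> v \<in> X - W}"
  define w p where "w = vec.dim W" and "p = vec.dim P"
  have wp: "w \<le> p"
    unfolding w_def p_def using Suc.prems by (intro vec.dim_subset)
  have Q: "?Q > 1"
    using card_scalars_ge_2[where 'a='a] by linarith
  have "real (card ?A) = real (card ?G) * (?Q ^ (w + Suc d) - ?Q ^ w)"
  proof (rule of_nat_card_eq_fibres[where f = snd])
    fix X assume X: "X \<in> ?G"
    have "{a \<in> ?A. snd a = X} = (\<lambda>v. (v, X)) ` (X - W)"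
      using X by auto
    then have "card {a \<in> ?A. snd a = X} = card (X - W)"
      by (simp add: card_image inj_on_def)
    then show "real (card {a \<in> ?A. snd a = X}) = ?Q ^ (w + Suc d) - ?Q ^ w"
      using X Suc.prems card_mono[of X W]
      by (simp add: card_Diff_subset card_subspace of_nat_diff w_def)
  qed auto
  moreover have "real (card ?A) = real (card (P - W)) * gauss_binom ?Q (p - w - 1) d"
  proof (rule of_nat_card_eq_fibres[where f = fst])
    fix v assume v: "v \<in> P - W"
    let ?W = "vec.span (insert v W)"
    have dW: "vec.dim ?W = Suc w"
      using dim_span_insert[OF Suc.prems(1)] v unfolding w_def by simp
    have "?W \<subseteq> X \<longleftrightarrow> W \<subseteq> X \<and> v \<in> X" if "vec.subspace X" for X
      using subset_span_insert[where W = W and v = v] span_insert_least[OF that, of W v] by blast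
    then have "{a \<in> ?A. fst a = v} = Pair v `
        {X. vec.subspace X \<and> ?W \<subseteq> X \<and> X \<subseteq> P \<and> vec.dim X = vec.dim ?W + d}"
      using v dW unfolding w_def by auto
    then have "card {a \<in> ?A. fst a = v} =
        card {X. vec.subspace X \<and> ?W \<subseteq> X \<and> X \<subseteq> P \<and> vec.dim X = vec.dim ?W + d}"
      by (simp add: card_image inj_on_def)
    then show "real (card {a \<in> ?A. fst a = v}) = gauss_binom ?Q (p - w - 1) d"
      using Suc.IH[of ?W] dW Suc.prems(2) span_insert_least[OF Suc.prems(2,3), of v] v
      by (simp add: p_def)
  qed auto
  moreover have "real (card (P - W)) = ?Q ^ p - ?Q ^ w"
    using Suc.prems card_mono[of P W]
    by (simp add: card_Diff_subset card_subspace of_nat_diff w_def p_def)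
  ultimately have "real (card ?G) * (?Q ^ (w + Suc d) - ?Q ^ w) =
      (?Q ^ p - ?Q ^ w) * gauss_binom ?Q (p - w - 1) d"
    by simp
  moreover have "?Q ^ (w + Suc d) - ?Q ^ w = ?Q ^ w * (?Q ^ Suc d - 1)"
    by (simp add: power_add algebra_simps)
  moreover have "?Q ^ p - ?Q ^ w = ?Q ^ w * (?Q ^ (p - w) - 1)"
    using wp by (simp add: algebra_simps flip: power_add)
  moreover have "?Q ^ Suc d - 1 \<noteq> 0"
    using one_less_power[OF Q, of "Suc d"] by linarith
  ultimately have "?Q ^ w * (real (card ?G) * (?Q ^ Suc d - 1)) =
      ?Q ^ w * ((?Q ^ (p - w) - 1) * gauss_binom ?Q (p - w - 1) d)"
    and nz: "?Q ^ Suc d - 1 \<noteq> 0"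
    by (simp_all only: mult_ac not_False_eq_True)
  then have "real (card ?G) * (?Q ^ Suc d - 1) = (?Q ^ (p - w) - 1) * gauss_binom ?Q (p - w - 1) d"
    using Q by simp
  then show ?case
    unfolding gauss_binom_Suc w_def[symmetric] p_def[symmetric]
    using nz by (simp add: eq_divide_eq)
qed

text \<open>Here \<open>w\<close> is the dimension of the space on which the map is given,
  \<open>u i\<close> are the dimensions of a chain of target subspaces and \<open>p i\<close> those
  prescribed for their preimages. The leading power counts extensions to the smallest preimage. Each
  Gaussian binomial chooses a preimage inside the next one, and the inner product counts the
  extensions across that step.\<close>

definition chain_count :: "real \<Rightarrow> nat \<Rightarrow> (nat \<Rightarrow> nat) \<Rightarrow> (nat \<Rightarrow> nat) \<Rightarrow> nat \<Rightarrow> real" where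
  "chain_count Q w u p l = Q ^ (u 0 * (p 0 - w)) *
    (\<Prod>i<l. gauss_binom Q (p (Suc i) - w) (p i - w) *
      (\<Prod>t<p (Suc i) - p i. Q ^ u (Suc i) - Q ^ (u i + t)))"

text \<open>Induction on \<open>l\<close>: choose the preimage \<open>X\<close> of \<open>U l\<close>, then a map on \<open>X\<close>, then its
  extension to \<open>P\<close>.\<close>

lemma card_Lin_preimage_dims:
  fixes P :: "('a::{field,finite} ^ 'n) set"
  assumes W: "vec.subspace W" and U: "\<And>i. vec.subspace (U i)" "\<And>i. U i \<subseteq> U (Suc i)"
    and g: "g \<in> Lin W (U 0)" and wp: "\<And>i. vec.dim W \<le> p i"
    and "vec.subspace P" "W \<subseteq> P" "vec.dim P = p l"
  shows "real (card {f \<in> Lin P (U l). restr W f = g \<and> (\<forall>i\<le>l. vec.dim {y \<in> P. f y \<in> U i} = p i)})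
    = chain_count (real CARD('a)) (vec.dim W) (\<lambda>i. vec.dim (U i)) p l"
  using assms(6-)
proof (induction l arbitrary: P)
  case 0
  have "{y \<in> P. f y \<in> U 0} = P" if "f \<in> Lin P (U 0)" for f
    using that by (auto dest: LinD(2))
  then have "{f \<in> Lin P (U 0). restr W f = g \<and> (\<forall>i\<le>0. vec.dim {y \<in> P. f y \<in> U i} = p i)} =
      {f \<in> Lin P (U 0). restr W f = g}"
    using 0 by auto
  then show ?case
    using 0 W U g by (simp add: card_Lin_extensions card_subspace chain_count_def power_mult)
next
  case (Suc l)
  let ?Q = "real CARD('a)"
  let ?C = "\<lambda>P l. {f \<in> Lin P (U l). restr W f = g \<and> (\<forall>i\<le>l. vec.dim {y \<in> P. f y \<in> U i} = p i)}"
  let ?G = "{X. vec.subspace X \<and> W \<subseteq> X \<and> X \<subseteq> P \<and> vec.dim X = vec.dim W + (p l - vec.dim W)}"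
  define e where "e = (\<Prod>t<p (Suc l) - p l. ?Q ^ vec.dim (U (Suc l)) - ?Q ^ (vec.dim (U l) + t))"
  have Ul: "U i \<subseteq> U l" if "i \<le> l" for i
    using that U(2) lift_Suc_mono_le by blast
  have WU: "f y \<in> U i" if "restr W f = g" "y \<in> W" for f y i
    using restr_eqD[OF that] LinD(2)[OF g that(2)] lift_Suc_mono_le[of U 0 i] U(2) by auto
  have "real (card (?C P (Suc l))) =
      real (card ?G) * (chain_count ?Q (vec.dim W) (\<lambda>i. vec.dim (U i)) p l * e)"
  proof (rule of_nat_card_eq_fibres[where f = "\<lambda>f. {y \<in> P. f y \<in> U l}"])
    fix f assume f: "f \<in> ?C P (Suc l)"
    then have "vec.subspace {y \<in> P. f y \<in> U l}"
      using Suc.prems U by (intro subspace_preimage) (auto dest: LinD(1))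
    moreover have "W \<subseteq> {y \<in> P. f y \<in> U l}"
      using f Suc.prems WU[of f] by auto
    ultimately show "{y \<in> P. f y \<in> U l} \<in> ?G"
      using f wp[of l] by auto
  next
    fix X assume X: "X \<in> ?G"
    let ?A = "{f \<in> ?C P (Suc l). {y \<in> P. f y \<in> U l} = X}"
    have dX: "vec.dim X = p l"
      using X wp[of l] by simp
    \<comment> \<open>For \<open>i \<le> l\<close> the preimage of \<open>U i\<close> already lies
      in \<open>X\<close>, so its dimension can be read off from the restriction to
      \<open>X\<close>.\<close>
    have eqi: "{y \<in> X. restr X f y \<in> U i} = {y \<in> P. f y \<in> U i}"
      if "{y \<in> P. f y \<in> U l} = X" "i \<le> l" for f i
    proof -
      have "y \<in> X" if "y \<in> P" "f y \<in> U i" for y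
        using that \<open>{y \<in> P. f y \<in> U l} = X\<close> Ul[OF \<open>i \<le> l\<close>] by auto
      then show ?thesis using X by (auto simp: restr_def)
    qed
    have "real (card ?A) = real (card (?C X l)) * e"
    proof (rule of_nat_card_eq_fibres[where f = "restr X"])
      fix f assume f: "f \<in> ?A"
      have "restr X f \<in> Lin X (U l)"
        by (rule restr_Lin[of f P "U (Suc l)"]) (use f X in auto)
      moreover have "restr W (restr X f) = g"
        using f X restr_restr[of W X f] by auto
      moreover have "vec.dim {y \<in> X. restr X f y \<in> U i} = p i" if "i \<le> l" for i
        using eqi[of f i] f that by simp
      ultimately show "restr X f \<in> ?C X l" by blast
    next
      fix h assume h: "h \<in> ?C X l"
      have "f \<in> ?C P (Suc l)"
        if f: "f \<in> Lin P (U (Suc l))" "restr X f = h" "{y \<in> P. f y \<in> U l} = X" for f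
      proof -
        have "restr W f = g"
          using h f X restr_restr[of W X f] by auto
        moreover have "vec.dim {y \<in> P. f y \<in> U i} = p i" if i: "i \<le> Suc l" for i
        proof (cases "i = Suc l")
          \<comment> \<open>The condition at the top index is automatic: \<open>f\<close> maps all
            of \<open>P\<close> into \<open>U (Suc l)\<close>, and \<open>P\<close> has the
            prescribed dimension.\<close>
          case True
          then have "{y \<in> P. f y \<in> U i} = P"
            using f(1) by (auto dest: LinD(2))
          then show ?thesis using True Suc.prems by simp
        next
          case False
          then have "i \<le> l" using i by simp
          then have "vec.dim {y \<in> X. h y \<in> U i} = p i" and "{y \<in> X. h y \<in> U i} = {y \<in> P. f y \<in> U i}"
            using h eqi[of f i] f by auto
          then show ?thesis by simp
        qed
        ultimately show ?thesis using f by blast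
      qed
      then have "{f \<in> ?A. restr X f = h} =
          {f \<in> Lin P (U (Suc l)). restr X f = h \<and> {y \<in> P. f y \<in> U l} = X}"
        by blast
      then show "real (card {f \<in> ?A. restr X f = h}) = e"
        using card_Lin_extensions_preimage[of X P "U l" "U (Suc l)" h] X h Suc.prems U dX
        by (simp add: e_def)
    qed auto
    then show "real (card ?A) = chain_count ?Q (vec.dim W) (\<lambda>i. vec.dim (U i)) p l * e"
      using Suc.IH[of X] X dX by simp
  qed auto
  also have "real (card ?G) = gauss_binom ?Q (vec.dim P - vec.dim W) (p l - vec.dim W)"
    by (rule card_intermediate_subspaces) (use W Suc.prems in auto)
  finally show ?case
    using Suc.prems by (simp add: chain_count_def e_def)
qed

section \<open>Extending a nilpotent map\<close>

text \<open>For a nilpotent \<open>f\<close> preserving \<open>V\<close> these are the partial sums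
  of its Jordan type on \<open>V\<close>; working with them avoids truncated differences.\<close>

definition kdim :: "('a::field ^ 'n \<Rightarrow> 'a ^ 'n) \<Rightarrow> ('a ^ 'n) set \<Rightarrow> nat \<Rightarrow> nat" where
  "kdim f V j = vec.dim {x \<in> V. (f ^^ j) x = 0}"

lemma funpow_Lin:
  assumes "f \<in> Lin V V"
  shows "x \<in> V \<Longrightarrow> (f ^^ j) x \<in> V" "linear_on V (f ^^ j)"
proof -
  have maps: "(f ^^ j) x \<in> V" if "x \<in> V" for x j
    using that by (induction j) (auto intro: LinD(2)[OF assms])
  then show "x \<in> V \<Longrightarrow> (f ^^ j) x \<in> V" .
  show "linear_on V (f ^^ j)"
    using linear_onD[OF LinD(1)[OF assms]] maps by (induction j) (simp_all add: linear_on_def)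
qed

lemma subspace_funpow_kernel:
  assumes "f \<in> Lin V V" "vec.subspace V"
  shows "vec.subspace {x \<in> V. (f ^^ j) x = 0}"
  using subspace_preimage[OF funpow_Lin(2)[OF assms(1)] assms(2), of "{0}"] by simp

lemma funpow_eq_on:
  assumes "\<And>x. x \<in> V \<Longrightarrow> f x = g x" "\<And>x. x \<in> V \<Longrightarrow> g x \<in> V" "x \<in> V"
  shows "(f ^^ j) x = (g ^^ j) x"
proof -
  have "(f ^^ j) x = (g ^^ j) x \<and> (g ^^ j) x \<in> V"
    using assms by (induction j) auto
  then show ?thesis ..
qed

text \<open>The intersection of \<open>g W\<close> with the kernel of the \<open>i\<close>-th power
  is the image of the kernel of the next power, and both \<open>W\<close> and that kernel contain
  the whole kernel of \<open>g\<close>; rank-nullity is applied to each. So the codimension of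
  \<open>U\<close> in \<open>W\<close> is the part of the Jordan type with index
  \<open>Suc i\<close>.\<close>

lemma dim_image_plus_kernel:
  fixes g :: "'a::{field,finite} ^ 'n \<Rightarrow> 'a ^ 'n" and i :: nat
  assumes g: "g \<in> Lin W W" and W: "vec.subspace W"
  defines "U \<equiv> {x + y |x y. x \<in> g ` W \<and> y \<in> {x \<in> W. (g ^^ i) x = 0}}"
  shows "vec.subspace U" "vec.dim U + kdim g W (Suc i) = vec.dim W + kdim g W i"
proof -
  let ?K = "\<lambda>i. {x \<in> W. (g ^^ i) x = 0}"
  have lin: "linear_on W g" by (rule LinD(1)[OF g])
  note g0 = linear_on_0[OF lin W]
  have K: "vec.subspace (?K i)" for i
    by (rule subspace_funpow_kernel[OF g W])
  have I: "vec.subspace (g ` W)"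
    by (rule subspace_linear_image[OF lin W])
  show "vec.subspace U"
    unfolding U_def by (rule vec.subspace_sums[OF I K])
  have "g ` W \<inter> ?K i = g ` ?K (Suc i)"
    using LinD(2)[OF g] by (auto simp: funpow_Suc_right simp del: funpow.simps(2))
  moreover have "vec.dim (?K (Suc i)) = vec.dim (g ` ?K (Suc i)) + vec.dim {x \<in> ?K (Suc i). g x = 0}"
    by (rule rank_nullity_on[OF linear_on_subset[OF lin] K]) auto
  moreover have "{x \<in> ?K (Suc i). g x = 0} = {x \<in> W. g x = 0}"
  proof -
    have "(g ^^ i) 0 = 0"
      by (induction i) (simp_all add: g0)
    then show ?thesis by (auto simp: funpow_Suc_right simp del: funpow.simps(2))
  qed
  moreover have "vec.dim W = vec.dim (g ` W) + vec.dim {x \<in> W. g x = 0}"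
    by (rule rank_nullity_on[OF lin W])
  moreover have "vec.dim U + vec.dim (g ` W \<inter> ?K i) = vec.dim (g ` W) + vec.dim (?K i)"
    unfolding U_def by (rule vec.dim_sums_Int[OF I K])
  ultimately show "vec.dim U + kdim g W (Suc i) = vec.dim W + kdim g W i"
    unfolding kdim_def by simp
qed

text \<open>The preimage of \<open>g W + ker g\<^sup>i\<close> under an extension \<open>f\<close> of \<open>g\<close> is \<open>W + ker f\<^sup>i\<^sup>+\<^sup>1\<close>; this
  translates the Jordan type of \<open>f\<close> into dimensions of preimages of subspaces depending on \<open>g\<close> only.\<close>

lemma dim_extension_preimage:
  fixes f :: "'a::{field,finite} ^ 'n \<Rightarrow> 'a ^ 'n" and i :: nat
  assumes f: "f \<in> Lin P W" and P: "vec.subspace P" and W: "vec.subspace W" and WP: "W \<subseteq> P"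
    and rf: "restr W f = g"
  defines "U \<equiv> {x + y |x y. x \<in> g ` W \<and> y \<in> {x \<in> W. (g ^^ i) x = 0}}"
  shows "vec.dim {y \<in> P. f y \<in> U} + kdim g W (Suc i) = vec.dim W + kdim f P (Suc i)"
proof -
  have fg: "f x = g x" if "x \<in> W" for x
    using restr_eqD[OF rf that] .
  have gW: "g x \<in> W" if "x \<in> W" for x
    using fg[OF that] LinD(2)[OF f, of x] WP that by auto
  have fg_pow: "(f ^^ j) x = (g ^^ j) x" if "x \<in> W" for x j
    using funpow_eq_on[of W f g] fg gW that by blast
  have fPP: "f \<in> Lin P P"
    using f WP by (auto simp: Lin_def)
  let ?K = "{x \<in> P. (f ^^ Suc i) x = 0}"
  have K: "vec.subspace ?K"
    by (rule subspace_funpow_kernel[OF fPP P])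
  have "{y \<in> P. f y \<in> U} = {x + y |x y. x \<in> W \<and> y \<in> ?K}"
  proof (intro equalityI subsetI)
    fix y assume y: "y \<in> {y \<in> P. f y \<in> U}"
    then obtain x z where xz: "x \<in> W" "z \<in> W" "(g ^^ i) z = 0" "f y = g x + z"
      unfolding U_def by auto
    have "f (y - x) = z"
      using linear_on_diff[OF LinD(1)[OF f] P, of y x] y xz WP fg[of x] by auto
    then have "(f ^^ Suc i) (y - x) = 0"
      using fg_pow[OF xz(2)] xz(3) by (simp add: funpow_Suc_right del: funpow.simps(2))
    moreover have "y - x \<in> P"
      using y xz WP vec.subspace_diff[OF P] by auto
    ultimately show "y \<in> {x + y |x y. x \<in> W \<and> y \<in> ?K}"
      using xz(1) by (intro CollectI exI[of _ x] exI[of _ "y - x"]) auto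
  next
    fix y assume "y \<in> {x + y |x y. x \<in> W \<and> y \<in> ?K}"
    then obtain x k where xk: "x \<in> W" "k \<in> P" "(f ^^ Suc i) k = 0" "y = x + k"
      by blast
    have "f y = g x + f k"
      using linear_onD(1)[OF LinD(1)[OF f], of x k] xk WP fg[of x] by auto
    moreover have "(g ^^ i) (f k) = 0"
      using xk(3) fg_pow[OF LinD(2)[OF f xk(2)]]
      by (simp add: funpow_Suc_right del: funpow.simps(2))
    ultimately show "y \<in> {y \<in> P. f y \<in> U}"
      unfolding U_def using xk WP LinD(2)[OF f xk(2)] vec.subspace_add[OF P] by auto
  qed
  moreover have "W \<inter> ?K = {x \<in> W. (g ^^ Suc i) x = 0}"
    using WP fg_pow[of _ "Suc i"] by (auto simp del: funpow.simps(2))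
  ultimately show ?thesis
    using vec.dim_sums_Int[OF W K] unfolding kdim_def by simp
qed

text \<open>\<open>M\<close> and \<open>\<Lambda>\<close> are the partial sums of the old and new
  Jordan types, both constant from \<open>L\<close> on. This reduces infinitely many kernel
  conditions to finitely many, so that the count along a finite chain applies.\<close>

lemma card_nilpotent_extensions:
  fixes P :: "('a::{field,finite} ^ 'n) set"
  assumes W: "vec.subspace W" and P: "vec.subspace P" and WP: "W \<subseteq> P"
    and g: "g \<in> Lin W W" and M: "\<And>i. kdim g W i = M i"
    and le: "\<And>i. M i \<le> \<Lambda> i" and \<Lambda>0: "\<Lambda> 0 = 0"
    and L: "\<And>i. i \<ge> L \<Longrightarrow> M i = vec.dim W" "\<And>i. i \<ge> L \<Longrightarrow> \<Lambda> i = vec.dim P"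
  shows "real (card {f \<in> Lin P W. restr W f = g \<and> (\<forall>i. kdim f P i = \<Lambda> i)})
    = chain_count (real CARD('a)) (vec.dim W) (\<lambda>i. vec.dim W + M i - M (Suc i))
        (\<lambda>i. vec.dim W + \<Lambda> (Suc i) - M (Suc i)) L"
proof -
  define U where "U i = {x + y |x y. x \<in> g ` W \<and> y \<in> {x \<in> W. (g ^^ i) x = 0}}" for i
  \<comment> \<open>The shift by one reflects that the preimage of \<open>U i\<close> controls the
    kernel of the power \<open>Suc i\<close>.\<close>
  let ?p = "\<lambda>i. vec.dim W + \<Lambda> (Suc i) - M (Suc i)"
  have U: "vec.subspace (U i)" "vec.dim (U i) + M (Suc i) = vec.dim W + M i" for i
    using dim_image_plus_kernel[OF g W, of i] M unfolding U_def by auto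
  have dU: "vec.dim (U i) = vec.dim W + M i - M (Suc i)" for i
    using U(2)[of i] by linarith
  have UW: "U i \<subseteq> W" for i
    unfolding U_def using LinD(2)[OF g] vec.subspace_add[OF W] by auto
  \<comment> \<open>From index \<open>L\<close> on the chain has reached \<open>W\<close>. Hence
    maps into \<open>W\<close> are maps into \<open>U L\<close>, and all later preimages are the
    whole of \<open>P\<close>.\<close>
  have U_eq: "U i = W" if "i \<ge> L" for i
    using dU[of i] L(1)[of i] L(1)[of "Suc i"] that
    by (intro subspace_eqI_dim[OF U(1) W UW]) simp
  have mono: "U i \<subseteq> U (Suc i)" for i
    unfolding U_def using linear_on_0[OF LinD(1)[OF g] W] by fastforce
  have gU: "g \<in> Lin W (U 0)"
  proof -
    have "g x = g x + 0 \<and> 0 \<in> {x \<in> W. (g ^^ 0) x = 0}" for x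
      using vec.subspace_0[OF W] by simp
    then show ?thesis
      using g unfolding U_def Lin_def by blast
  qed
  have dim: "vec.dim {y \<in> P. f y \<in> U i} + M (Suc i) = vec.dim W + kdim f P (Suc i)"
    if "f \<in> Lin P W" "restr W f = g" for f i
    using dim_extension_preimage[OF that(1) P W WP that(2), of i] M unfolding U_def by simp
  have dim_iff: "vec.dim {y \<in> P. f y \<in> U i} = ?p i \<longleftrightarrow> kdim f P (Suc i) = \<Lambda> (Suc i)"
    if "f \<in> Lin P W" "restr W f = g" for f i
    using dim[OF that, of i] le[of "Suc i"] by linarith
  have "(\<forall>i\<le>L. vec.dim {y \<in> P. f y \<in> U i} = ?p i) \<longleftrightarrow> (\<forall>i. kdim f P i = \<Lambda> i)"
    if f: "f \<in> Lin P W" "restr W f = g" for f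
  proof
    assume a: "\<forall>i\<le>L. vec.dim {y \<in> P. f y \<in> U i} = ?p i"
    show "\<forall>i. kdim f P i = \<Lambda> i"
    proof
      fix i show "kdim f P i = \<Lambda> i"
      proof (cases i)
        case 0
        have "{x \<in> P. x = 0} = {0}" using vec.subspace_0[OF P] by auto
        then show ?thesis using 0 \<Lambda>0 by (simp add: kdim_def)
      next
        case (Suc j)
        show ?thesis
        proof (cases "j \<le> L")
          case True
          then show ?thesis using a dim_iff[OF f, of j] Suc by simp
        next
          case False
          then have "{y \<in> P. f y \<in> U j} = P"
            using U_eq[of j] LinD(2)[OF f(1)] by auto
          then show ?thesis
            using dim[OF f, of j] L[of "Suc j"] False Suc by simp
        qed
      qed
    qed
  next
    assume "\<forall>i. kdim f P i = \<Lambda> i"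
    then show "\<forall>i\<le>L. vec.dim {y \<in> P. f y \<in> U i} = ?p i"
      using dim_iff[OF f] by blast
  qed
  then have "{f \<in> Lin P W. restr W f = g \<and> (\<forall>i. kdim f P i = \<Lambda> i)} =
      {f \<in> Lin P (U L). restr W f = g \<and> (\<forall>i\<le>L. vec.dim {y \<in> P. f y \<in> U i} = ?p i)}"
    using U_eq[of L] by auto
  moreover have "real (card {f \<in> Lin P (U L). restr W f = g \<and> (\<forall>i\<le>L. vec.dim {y \<in> P. f y \<in> U i} = ?p i)})
    = chain_count (real CARD('a)) (vec.dim W) (\<lambda>i. vec.dim (U i)) ?p L"
  proof (rule card_Lin_preimage_dims)
    show "vec.dim W \<le> ?p i" for i
      using le[of "Suc i"] by simp
  qed (use W P WP U(1) mono gU L in auto)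
  ultimately show ?thesis
    by (simp add: dU)
qed

section \<open>Flags with a strictly compatible map\<close>

text \<open>The ambient space \<open>V\<close> is arbitrary, so that restricting to a smaller member
  of the flag gives data of the same form. Jordan types enter through the kernel dimensions
  \<open>M i j\<close>.\<close>

definition flag_maps ::
    "(nat \<Rightarrow> nat) \<Rightarrow> (nat \<Rightarrow> nat \<Rightarrow> nat) \<Rightarrow> nat \<Rightarrow> ('a::field ^ 'n) set \<Rightarrow> (('a ^ 'n) set list \<times> ('a ^ 'n \<Rightarrow> 'a ^ 'n)) set" where
  "flag_maps c M k V = {(F, f). length F = Suc k \<and> F ! 0 = {0} \<and> F ! k = V
     \<and> (\<forall>i\<le>k. vec.subspace (F ! i) \<and> vec.dim (F ! i) = c i) \<and> (\<forall>i<k. F ! i \<subseteq> F ! Suc i)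
     \<and> f \<in> Lin V V \<and> (\<forall>i<k. f ` (F ! Suc i) \<subseteq> F ! i) \<and> (\<forall>i\<le>k. \<forall>j. kdim f (F ! i) j = M i j)}"

text \<open>The three factors of the recursion count the last proper subspace of the flag, the pairs
  on that subspace, and the extensions of the map to the full space.\<close>

fun flag_count :: "real \<Rightarrow> (nat \<Rightarrow> nat) \<Rightarrow> (nat \<Rightarrow> nat \<Rightarrow> nat) \<Rightarrow> nat \<Rightarrow> nat \<Rightarrow> real" where
  "flag_count Q c M L 0 = 1"
| "flag_count Q c M L (Suc k) = gauss_binom Q (c (Suc k)) (c k) *
     (flag_count Q c M L k * chain_count Q (c k) (\<lambda>i. c k + M k i - M k (Suc i))
        (\<lambda>i. c k + M (Suc k) (Suc i) - M k (Suc i)) L)"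

lemma finite_flag_maps:
  "finite (flag_maps c M k (V :: ('a::{field,finite} ^ 'n) set))"
proof (rule finite_subset)
  show "flag_maps c M k V \<subseteq> {F. set F \<subseteq> UNIV \<and> length F = Suc k} \<times> UNIV"
    by (auto simp: flag_maps_def)
qed (intro finite_cartesian_product finite_lists_length_eq finite)

lemma kdim_cong:
  assumes "\<And>x. x \<in> W \<Longrightarrow> f x = g x" "\<And>x. x \<in> W \<Longrightarrow> g x \<in> W" "V \<subseteq> W"
  shows "kdim f V j = kdim g V j"
proof -
  have "(f ^^ j) x = (g ^^ j) x" if "x \<in> V" for x
    using funpow_eq_on[of W f g x j] assms that by blast
  then have "{x \<in> V. (f ^^ j) x = 0} = {x \<in> V. (g ^^ j) x = 0}" by auto
  then show ?thesis unfolding kdim_def by simp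
qed

lemma chain_subset_last:
  assumes "\<forall>i<k. F ! i \<subseteq> F ! Suc i" "i \<le> k"
  shows "F ! i \<subseteq> F ! k"
  using assms(2,1) by (induction rule: inc_induct) auto

text \<open>Over a fixed restricted pair the flag is forced, and all conditions on its smaller
  members depend on \<open>g\<close> alone. Only the values of \<open>f\<close> in \<open>W\<close>
  and its type on \<open>P\<close> remain to be imposed.\<close>

lemma flag_maps_Suc_fibre:
  fixes P :: "('a::field ^ 'n) set"
  assumes P: "vec.subspace P" "vec.dim P = c (Suc k)" and WP: "W \<subseteq> P"
    and Gg: "(G, g) \<in> flag_maps c M k W"
  shows "{a \<in> flag_maps c M (Suc k) P. fst a ! k = W \<and> butlast (fst a) = G \<and> restr W (snd a) = g} =
    Pair (G @ [P]) ` {f \<in> Lin P W. restr W f = g \<and> (\<forall>i. kdim f P i = M (Suc k) i)}"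
proof (intro equalityI subsetI)
  fix a assume a: "a \<in> {a \<in> flag_maps c M (Suc k) P. fst a ! k = W \<and> butlast (fst a) = G \<and> restr W (snd a) = g}"
  obtain F f where Ff: "a = (F, f)" by (cases a)
  have F: "length F = Suc (Suc k)" "F ! Suc k = P" "F ! k = W" "butlast F = G"
    using a Ff by (auto simp: flag_maps_def)
  then have "last F = P"
    by (cases "F = []") (simp_all add: last_conv_nth)
  moreover have "F \<noteq> []"
    using F(1) by auto
  ultimately have "F = G @ [P]"
    using F(4) append_butlast_last_id[of F] by simp
  moreover have "f \<in> Lin P P" "\<forall>i<Suc k. f ` (F ! Suc i) \<subseteq> F ! i"
      "\<forall>i\<le>Suc k. \<forall>j. kdim f (F ! i) j = M i j"
    using a Ff by (simp_all add: flag_maps_def)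
  then have "f \<in> Lin P W" "\<forall>j. kdim f P j = M (Suc k) j"
    using F by (auto simp: Lin_def)
  moreover have "restr W f = g"
    using a Ff by auto
  ultimately show "a \<in> Pair (G @ [P]) ` {f \<in> Lin P W. restr W f = g \<and> (\<forall>i. kdim f P i = M (Suc k) i)}"
    using Ff by blast
next
  fix a assume "a \<in> Pair (G @ [P]) ` {f \<in> Lin P W. restr W f = g \<and> (\<forall>i. kdim f P i = M (Suc k) i)}"
  then obtain f where f: "a = (G @ [P], f)" "f \<in> Lin P W" "restr W f = g" "\<forall>i. kdim f P i = M (Suc k) i"
    by blast
  have G: "length G = Suc k" "G ! 0 = {0}" "G ! k = W"
    "\<And>i. i \<le> k \<Longrightarrow> vec.subspace (G ! i) \<and> vec.dim (G ! i) = c i"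
    "\<forall>i<k. G ! i \<subseteq> G ! Suc i" "g \<in> Lin W W" "\<And>i. i < k \<Longrightarrow> g ` (G ! Suc i) \<subseteq> G ! i"
    "\<And>i j. i \<le> k \<Longrightarrow> kdim g (G ! i) j = M i j"
    using Gg by (auto simp: flag_maps_def)
  have GW: "G ! i \<subseteq> W" if "i \<le> k" for i
    using chain_subset_last[OF G(5) that] G(3) by simp
  have fg: "f x = g x" if "x \<in> W" for x
    using restr_eqD[OF f(3) that] .
  have nth: "(G @ [P]) ! i = (if i \<le> k then G ! i else P)" if "i \<le> Suc k" for i
    using that G(1) by (auto simp: nth_append)
  have "kdim f (G ! i) j = M i j" if "i \<le> k" for i j
    using kdim_cong[of W f g "G ! i" j] fg LinD(2)[OF G(6)] GW[OF that] G(8)[OF that] by simp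
  moreover have "f ` (G ! Suc i) \<subseteq> G ! i" if "i < k" for i
    using G(7)[OF that] GW[of "Suc i"] fg that by force
  moreover have "f \<in> Lin P P"
    using f(2) WP by (auto simp: Lin_def)
  ultimately have "(G @ [P], f) \<in> flag_maps c M (Suc k) P"
    unfolding flag_maps_def using G f P WP LinD(2)[OF f(2)]
    by (auto simp: nth less_Suc_eq le_Suc_eq)
  then show "a \<in> {a \<in> flag_maps c M (Suc k) P. fst a ! k = W \<and> butlast (fst a) = G \<and> restr W (snd a) = g}"
    using f G nth[of k] by auto
qed

lemma flag_maps_Suc_restrict:
  assumes "(F, f) \<in> flag_maps c M (Suc k) P"
  shows "(butlast F, restr (F ! k) f) \<in> flag_maps c M k (F ! k)"
proof -
  have F: "length F = Suc (Suc k)" "F ! 0 = {0}" "F ! Suc k = P"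
    "\<And>i. i \<le> Suc k \<Longrightarrow> vec.subspace (F ! i) \<and> vec.dim (F ! i) = c i"
    "\<forall>i<Suc k. F ! i \<subseteq> F ! Suc i" "f \<in> Lin P P" "\<And>i. i < Suc k \<Longrightarrow> f ` (F ! Suc i) \<subseteq> F ! i"
    "\<And>i j. i \<le> Suc k \<Longrightarrow> kdim f (F ! i) j = M i j"
    using assms by (auto simp: flag_maps_def)
  let ?W = "F ! k"
  have WP: "?W \<subseteq> P" and fPW: "f ` P \<subseteq> ?W"
    using F(3,5,7) by blast+
  have sub: "F ! i \<subseteq> ?W" if "i \<le> k" for i
    using chain_subset_last[of k F i] F(5) that by simp
  have g: "restr ?W f \<in> Lin ?W ?W"
    by (rule restr_Lin[OF F(6)]) (use F(4) WP fPW in auto)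
  have "kdim (restr ?W f) (F ! i) j = M i j" if "i \<le> k" for i j
    using kdim_cong[of ?W "restr ?W f" f "F ! i" j] sub[OF that] F(8)[of i j] that WP fPW
    by (auto simp: restr_def)
  moreover have "restr ?W f ` (F ! Suc i) \<subseteq> F ! i" if "i < k" for i
    using F(7)[of i] sub[of "Suc i"] that by (auto simp: restr_def)
  ultimately show ?thesis
    unfolding flag_maps_def using F g by (auto simp: nth_butlast)
qed

text \<open>The set is fibred first over the last proper subspace, then over the restricted pair. A
  single \<open>L\<close> bounds the index of stabilisation for every member of the flag.\<close>

lemma card_flag_maps:
  fixes V :: "('a::{field,finite} ^ 'n) set"
  assumes "vec.subspace V" "vec.dim V = c k"
    and le: "\<And>k i. M k i \<le> M (Suc k) i" and M0: "\<And>k. M k 0 = 0" "\<And>i. M 0 i = 0" and c0: "c 0 = 0"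
    and L: "\<And>k i. i \<ge> L \<Longrightarrow> M k i = c k"
  shows "real (card (flag_maps c M k V)) = flag_count (real CARD('a)) c M L k"
  using assms(1,2)
proof (induction k arbitrary: V)
  case 0
  then have V: "V = {0}"
    using c0 vec.subspace_0[OF 0(1)] subspace_eqI_dim[of "{0}" V] by simp
  have kdim0: "kdim f {0} j = 0" for f :: "'a ^ 'n \<Rightarrow> 'a ^ 'n" and j
  proof -
    have "{x \<in> {0}. (f ^^ j) x = 0} \<subseteq> {0}" by blast
    from vec.dim_subset[OF this] show ?thesis unfolding kdim_def by simp
  qed
  have Lin0: "Lin {0} {0} = {\<lambda>_ :: 'a ^ 'n. 0}"
  proof (intro equalityI subsetI)
    fix f :: "'a ^ 'n \<Rightarrow> 'a ^ 'n" assume f: "f \<in> Lin {0} {0}"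
    have "f x = 0" for x
      using LinD(2)[OF f, of x] LinD(3)[OF f, of x] by (cases "x = 0") simp_all
    then show "f \<in> {\<lambda>_. 0}" by (simp add: fun_eq_iff)
  qed (simp add: Lin_def linear_on_def)
  have sub0: "vec.subspace {0 :: 'a ^ 'n}"
    using 0(1) V by simp
  have "(F, f) \<in> flag_maps c M 0 V \<longleftrightarrow> F = [{0}] \<and> f = (\<lambda>_. 0)" for F f
  proof
    assume a: "(F, f) \<in> flag_maps c M 0 V"
    then have "length F = 1" "F ! 0 = {0}"
      by (simp_all add: flag_maps_def)
    then have "F = [{0}]"
      by (cases F) simp_all
    then show "F = [{0}] \<and> f = (\<lambda>_. 0)"
      using a Lin0 V by (simp add: flag_maps_def)
  next
    assume "F = [{0}] \<and> f = (\<lambda>_. 0)"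
    then show "(F, f) \<in> flag_maps c M 0 V"
      using V Lin0 sub0 by (simp add: flag_maps_def kdim0 M0 c0)
  qed
  then have "flag_maps c M 0 V = {([{0}], \<lambda>_. 0)}"
    by auto
  then show ?case by simp
next
  case (Suc k)
  let ?Q = "real CARD('a)"
  let ?A = "flag_maps c M (Suc k) V"
  \<comment> \<open>The trivial inclusion and the summand of dimension zero bring the set into the
    form of the count of intermediate subspaces, taken above the zero space.\<close>
  let ?G = "{X. vec.subspace X \<and> {0} \<subseteq> X \<and> X \<subseteq> V \<and> vec.dim X = vec.dim {0 :: 'a ^ 'n} + c k}"
  define e where "e = chain_count ?Q (c k) (\<lambda>i. c k + M k i - M k (Suc i))
        (\<lambda>i. c k + M (Suc k) (Suc i) - M k (Suc i)) L"
  have "real (card ?A) = real (card ?G) * (flag_count ?Q c M L k * e)"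
  proof (rule of_nat_card_eq_fibres[where f = "\<lambda>a. fst a ! k"])
    fix a assume a: "a \<in> ?A"
    obtain F f where Ff: "a = (F, f)" by (cases a)
    then have "vec.subspace (F ! k)" "vec.dim (F ! k) = c k"
      "\<forall>i<Suc k. F ! i \<subseteq> F ! Suc i" "F ! Suc k = V"
      using a by (simp_all add: flag_maps_def)
    moreover from this have "F ! k \<subseteq> V"
      by blast
    ultimately show "fst a ! k \<in> ?G"
      using Ff by (auto simp: vec.subspace_0)
  next
    fix W assume W: "W \<in> ?G"
    let ?B = "{a \<in> ?A. fst a ! k = W}"
    have "real (card ?B) = real (card (flag_maps c M k W)) * e"
    proof (rule of_nat_card_eq_fibres[where f = "\<lambda>a. (butlast (fst a), restr W (snd a))"])
      fix a assume "a \<in> ?B"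
      then show "(butlast (fst a), restr W (snd a)) \<in> flag_maps c M k W"
        using flag_maps_Suc_restrict[of "fst a" "snd a"] by auto
    next
      fix b assume b: "b \<in> flag_maps c M k W"
      obtain G g where Gg: "b = (G, g)" by (cases b)
      then have g: "g \<in> Lin W W" "\<And>j. kdim g W j = M k j"
        using b by (auto simp: flag_maps_def)
      have "{a \<in> ?B. (butlast (fst a), restr W (snd a)) = b} =
        {a \<in> ?A. fst a ! k = W \<and> butlast (fst a) = G \<and> restr W (snd a) = g}"
        using Gg by auto
      also have "\<dots> = Pair (G @ [V]) ` {f \<in> Lin V W. restr W f = g \<and> (\<forall>i. kdim f V i = M (Suc k) i)}"
        by (rule flag_maps_Suc_fibre) (use Suc.prems W b Gg in auto)
      finally have "card {a \<in> ?B. (butlast (fst a), restr W (snd a)) = b} =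
        card {f \<in> Lin V W. restr W f = g \<and> (\<forall>i. kdim f V i = M (Suc k) i)}"
        by (simp add: card_image inj_on_def)
      also have "real \<dots> = e"
      proof -
        have dW: "vec.dim W = c k"
          using W by simp
        show ?thesis
          unfolding e_def dW[symmetric]
          by (rule card_nilpotent_extensions) (use W g le M0(1) L dW Suc.prems in \<open>simp_all only: mem_Collect_eq\<close>)
      qed
      finally show "real (card {a \<in> ?B. (butlast (fst a), restr W (snd a)) = b}) = e" .
    qed (simp_all add: finite_flag_maps)
    then show "real (card ?B) = flag_count ?Q c M L k * e"
      using Suc.IH[of W] W by simp
  qed (simp_all add: finite_flag_maps)
  also have "real (card ?G) = gauss_binom ?Q (vec.dim V - vec.dim {0 :: 'a ^ 'n}) (c k)"
    by (rule card_intermediate_subspaces) (use Suc.prems vec.subspace_0 in auto)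
  finally show ?case
    using Suc.prems by (simp add: e_def)
qed

section \<open>Evaluation in terms of q-factorials\<close>

lemma qfact_Suc: "qfact q (Suc m) = qint q (Suc m) * qfact q m"
  unfolding qfact_def by (simp add: mult.commute)

lemma qfact_0 [simp]: "qfact q 0 = 1"
  unfolding qfact_def by simp

lemma qint_pos: "0 < q \<Longrightarrow> 0 < r \<Longrightarrow> 0 < qint q r"
  unfolding qint_def by (intro sum_pos) auto

lemma qfact_pos: "0 < q \<Longrightarrow> 0 < qfact q m"
  unfolding qfact_def by (intro prod_pos) (auto intro: qint_pos)

lemma choose_two_add: "(x + t) choose 2 = (x choose 2) + x * t + (t choose 2)"
  by (induction t) (simp_all add: numeral_2_eq_2)

lemma choose_two_twice: "2 * int (a choose 2) = int a * (int a - 1)"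
  by (induction a) (simp_all add: numeral_2_eq_2 algebra_simps)

text \<open>The sum of mixed products is the exponent contributed by the Gaussian binomials of a
  chain; the identity trades it for binomial coefficients of the increments and of their
  total.\<close>

lemma choose_two_sum:
  fixes b :: "nat \<Rightarrow> nat"
  shows "(\<Sum>i\<le>n. b i) choose 2 = (\<Sum>i\<le>n. b i choose 2) + (\<Sum>i<n. (\<Sum>r\<le>i. b r) * b (Suc i))"
  by (induction n) (simp_all add: choose_two_add)

context
  fixes Q q :: real
  assumes Q: "Q > 1" and q: "q = 1 / Q"
begin

lemma q_pos: "q > 0"
  using Q q by simp

text \<open>Pulling out the larger power leaves \<open>1 - q ^ (r - s)\<close>, a geometric sum in
  the inverse of the field size.\<close>

lemma power_diff_qint: "s \<le> r \<Longrightarrow> Q ^ (u + r) - Q ^ (u + s) = Q ^ (u + r) * (1 - q) * qint q (r - s)"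
proof -
  assume "s \<le> r"
  then have "Q ^ (u + r) = Q ^ (u + s) * Q ^ (r - s)"
    by (simp flip: power_add)
  moreover have "Q ^ (r - s) * q ^ (r - s) = 1"
    using Q q by (simp flip: power_mult_distrib)
  moreover have "1 - q ^ (r - s) = (1 - q) * qint q (r - s)"
    unfolding qint_def by (rule one_diff_power_eq)
  ultimately show ?thesis
    by (simp add: mult.assoc flip: \<open>1 - q ^ (r - s) = _\<close>) (simp add: algebra_simps)
qed

text \<open>Each factor of \<open>gauss_binom\<close> contributes \<open>Q ^ (D - d)\<close> when
  the parameter is inverted.\<close>

lemma gauss_binom_qfact:
  "d \<le> D \<Longrightarrow> gauss_binom Q D d = Q ^ (d * (D - d)) * qfact q D / (qfact q d * qfact q (D - d))"
proof (induction d arbitrary: D)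
  case 0
  then show ?case using qfact_pos[OF q_pos, of D] by (simp add: gauss_binom_def)
next
  case (Suc d)
  then obtain E where D: "D = Suc (d + E)"
    by (metis Suc_le_D Suc_le_mono le_Suc_ex)
  have qD: "Q ^ Suc (d + E) - 1 = Q ^ Suc (d + E) * (1 - q) * qint q (Suc (d + E))"
    and qd: "Q ^ Suc d - 1 = Q ^ Suc d * (1 - q) * qint q (Suc d)"
    using power_diff_qint[of 0 "Suc (d + E)" 0] power_diff_qint[of 0 "Suc d" 0] by simp_all
  have "1 - q > 0"
    using Q q by simp
  then have "(Q ^ Suc (d + E) - 1) / (Q ^ Suc d - 1) = Q ^ E * qint q (Suc (d + E)) / qint q (Suc d)"
    unfolding qD qd using Q qint_pos[OF q_pos, of "Suc d"]
    by (simp add: field_simps power_add)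
  moreover have "gauss_binom Q (d + E) d = Q ^ (d * E) * qfact q (d + E) / (qfact q d * qfact q E)"
    using Suc.IH[of "d + E"] by simp
  ultimately show ?case
    unfolding D gauss_binom_Suc by (simp add: qfact_Suc power_add mult_ac)
qed

text \<open>Factor \<open>t\<close> is \<open>Q ^ (u + r) * (1 - q)\<close> times the q-integer of
  \<open>r - t\<close>, and these q-integers multiply to a quotient of q-factorials.\<close>

lemma prod_power_diff_qfact:
  "d \<le> r \<Longrightarrow> (\<Prod>t<d. Q ^ (u + r) - Q ^ (u + t)) =
    Q ^ (d * (u + r)) * (1 - q) ^ d * qfact q r / qfact q (r - d)"
proof (induction d)
  case 0
  then show ?case using qfact_pos[OF q_pos, of r] by simp
next
  case (Suc d)
  then obtain E where r: "r = Suc (d + E)"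
    by (metis Suc_le_D Suc_le_mono le_Suc_ex)
  have "Q ^ (u + r) - Q ^ (u + d) = Q ^ (u + r) * (1 - q) * qint q (Suc E)"
    using power_diff_qint[of d r u] r by simp
  then have "(\<Prod>t<Suc d. Q ^ (u + r) - Q ^ (u + t)) =
      Q ^ (d * (u + r)) * (1 - q) ^ d * qfact q r / (qint q (Suc E) * qfact q E) *
      (Q ^ (u + r) * (1 - q) * qint q (Suc E))"
    using Suc r by (simp add: qfact_Suc)
  also have "\<dots> = Q ^ (Suc d * (u + r)) * (1 - q) ^ Suc d * qfact q r / qfact q E"
  proof -
    have "Q ^ (Suc d * (u + r)) = Q ^ (u + r) * Q ^ (d * (u + r))"
      by (simp only: mult_Suc power_add)
    then show ?thesis
      using qint_pos[OF q_pos, of "Suc E"] by (simp only: power_Suc) simp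
  qed
  finally show ?case
    using r by simp
qed

text \<open>\<open>x\<close> and \<open>y\<close> are the old and new Jordan types, with rows
  counted from 0; they interlace, and \<open>b i\<close> is the number of cells added in row
  \<open>i\<close>. The q-factorials of the partial sums \<open>s i\<close> coming from the Gaussian
  binomials telescope, leaving only that of \<open>s l\<close>.\<close>

lemma chain_count_qfact:
  fixes x y :: "nat \<Rightarrow> nat"
  assumes xy: "\<And>i. x i \<le> y i" and yx: "\<And>i. y (Suc i) \<le> x i" and xm: "\<And>i. x i \<le> m"
  defines "b \<equiv> \<lambda>i. y i - x i"
  defines "s \<equiv> \<lambda>i. \<Sum>r\<le>i. b r"
  shows "chain_count Q m (\<lambda>i. m - x i) (\<lambda>i. m + s i) l =
    Q ^ ((\<Sum>i\<le>l. b i * (m - x i)) + (\<Sum>i<l. s i * b (Suc i))) * (1 - q) ^ (\<Sum>i<l. b (Suc i)) *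
    (qfact q (s l) / (\<Prod>i\<le>l. qfact q (b i))) *
    (\<Prod>i<l. qfact q (x i - x (Suc i)) / qfact q (x i - y (Suc i)))"
proof (induction l)
  case 0
  then show ?case
    using qfact_pos[OF q_pos, of "b 0"] by (simp add: chain_count_def s_def mult.commute)
next
  case (Suc l)
  have s_Suc: "s (Suc l) = s l + b (Suc l)"
    unfolding s_def by simp
  have "gauss_binom Q (m + s (Suc l) - m) (m + s l - m) =
      Q ^ (s l * b (Suc l)) * qfact q (s (Suc l)) / (qfact q (s l) * qfact q (b (Suc l)))"
    using gauss_binom_qfact[of "s l" "s (Suc l)"] s_Suc by simp
  moreover have "(\<Prod>t<m + s (Suc l) - (m + s l). Q ^ (m - x (Suc l)) - Q ^ (m - x l + t)) =
      Q ^ (b (Suc l) * (m - x (Suc l))) * (1 - q) ^ b (Suc l) *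
      (qfact q (x l - x (Suc l)) / qfact q (x l - y (Suc l)))"
  proof -
    have d: "m + s (Suc l) - (m + s l) = b (Suc l)"
      using s_Suc by simp
    \<comment> \<open>Interlacing makes all these truncated differences exact.\<close>
    have e: "m - x l + (x l - x (Suc l)) = m - x (Suc l)"
      "x l - x (Suc l) - b (Suc l) = x l - y (Suc l)" and le: "b (Suc l) \<le> x l - x (Suc l)"
      using xy[of "Suc l"] yx[of l] xm[of l] unfolding b_def by auto
    show ?thesis
      using prod_power_diff_qfact[OF le, of "m - x l"] unfolding d e times_divide_eq_right .
  qed
  moreover have "chain_count Q m (\<lambda>i. m - x i) (\<lambda>i. m + s i) (Suc l) =
      chain_count Q m (\<lambda>i. m - x i) (\<lambda>i. m + s i) l *
      (gauss_binom Q (m + s (Suc l) - m) (m + s l - m) *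
       (\<Prod>t<m + s (Suc l) - (m + s l). Q ^ (m - x (Suc l)) - Q ^ (m - x l + t)))"
    unfolding chain_count_def by simp
  ultimately show ?case
    unfolding Suc.IH using qfact_pos[OF q_pos, of "s l"]
    by (simp add: power_add mult_ac)
qed

end

text \<open>\<open>t k i\<close> is row \<open>i\<close>, counted from 0, of the shape at step
  \<open>k\<close>. One more step multiplies by a Gaussian binomial and a chain count; in the
  product the q-factorials of the old row differences cancel, and the new weight factor appears
  together with the new denominator.\<close>

lemma flag_count_qfact:
  fixes t :: "nat \<Rightarrow> nat \<Rightarrow> nat" and Q q :: real
  assumes Q: "Q > 1" and q: "q = 1 / Q"
    and t0: "\<And>i. t 0 i = 0" and t_mono: "\<And>k i. t k i \<le> t (Suc k) i"
    and t_strip: "\<And>k i. t (Suc k) (Suc i) \<le> t k i" and tn: "\<And>k i. i \<ge> n \<Longrightarrow> t k i = 0"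
  defines "M \<equiv> \<lambda>k j. \<Sum>i<j. t k i"
  defines "c \<equiv> \<lambda>k. \<Sum>i<n. t k i"
  shows "flag_count Q c M n k =
    q powi (- int ((c k)\<^sup>2) + int (c k) + int (\<Sum>i<n. t k i choose 2) + int (\<Sum>j<k. (c (Suc j) - c j) choose 2))
    * (1 - q) ^ (c k - t k 0) * qfact q (c k) / (\<Prod>i<n. qfact q (t k i - t k (Suc i)))
    * (\<Prod>j<k. \<Prod>i<n. qbinom q (t (Suc j) i - t (Suc j) (Suc i)) (t (Suc j) i - t j i))"
proof (induction k)
  case 0
  then show ?case by (simp add: t0 c_def binomial_eq_0)
next
  case (Suc k)
  have q_pos: "q > 0" using Q q by simp
  have nz: "qfact q m \<noteq> 0" for m using qfact_pos[OF q_pos, of m] by simp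
  define x y where "x = t k" and "y = t (Suc k)"
  define b s where "b i = y i - x i" and "s i = (\<Sum>r\<le>i. b r)" for i
  define m a where "m = c k" and "a = s n"
  note xy = t_mono[of k, folded x_def y_def] and yx = t_strip[of k, folded x_def y_def]
  have yb: "y i = x i + b i" for i
    unfolding b_def using xy[of i] by simp
  have s_lt: "s i = (\<Sum>r<Suc i. b r)" for i
    unfolding s_def by (simp only: lessThan_Suc_atMost)
  \<comment> \<open>Row \<open>n\<close> is empty at every step, which reconciles ranges up to and
    including \<open>n\<close> with ranges below \<open>n\<close>.\<close>
  have bn: "b n = 0"
    unfolding b_def x_def y_def using tn by simp
  have xm: "x i \<le> m" for i
  proof (cases "i < n")
    case True
    then show ?thesis
      unfolding m_def c_def x_def using member_le_sum[of i "{..<n}" "t k"] by simp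
  qed (simp add: x_def tn)
  have a_lt: "a = (\<Sum>r<n. b r)"
    unfolding a_def s_lt using bn by simp
  have c_Suc: "c (Suc k) = m + a"
    unfolding c_def m_def a_lt x_def[symmetric] y_def[symmetric] yb sum.distrib ..
  have M_Suc: "M (Suc k) (Suc i) = M k (Suc i) + s i" for i
    unfolding M_def s_lt x_def[symmetric] y_def[symmetric] yb sum.distrib ..
  have "m + M k i - M k (Suc i) = m - x i" for i
    unfolding M_def x_def by simp
  then have chain: "flag_count Q c M n (Suc k) =
      gauss_binom Q (m + a) m * (flag_count Q c M n k * chain_count Q m (\<lambda>i. m - x i) (\<lambda>i. m + s i) n)"
    by (simp add: M_Suc c_Suc flip: m_def)
  define X where "X = (\<Sum>i\<le>n. b i * (m - x i)) + (\<Sum>i<n. s i * b (Suc i))"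
  define B where "B = (\<Sum>i<n. b (Suc i))"
  define PX PY PB PXY where "PX = (\<Prod>i<n. qfact q (x i - x (Suc i)))"
    and "PY = (\<Prod>i<n. qfact q (y i - y (Suc i)))"
    and "PB = (\<Prod>i<n. qfact q (b i))" and "PXY = (\<Prod>i<n. qfact q (x i - y (Suc i)))"
  have nzs: "PX \<noteq> 0" "PY \<noteq> 0"
    unfolding PX_def PY_def using nz by simp_all
  have chain_count: "chain_count Q m (\<lambda>i. m - x i) (\<lambda>i. m + s i) n =
      Q ^ X * (1 - q) ^ B * (qfact q a / PB) * (PX / PXY)"
  proof -
    have "(\<Prod>i\<le>n. qfact q (b i)) = PB"
      unfolding PB_def lessThan_Suc_atMost[symmetric] by (simp add: bn)
    then show ?thesis
      using chain_count_qfact[OF Q q, of x y m n, OF xy yx xm]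
      unfolding b_def[symmetric] s_def[symmetric] X_def[symmetric] B_def[symmetric] a_def[symmetric]
        prod_dividef PX_def[symmetric] PXY_def[symmetric]
      by simp
  qed
  have binom: "(\<Prod>i<n. qbinom q (y i - y (Suc i)) (b i)) = PY / (PB * PXY)"
  proof -
    have "y i - y (Suc i) - b i = x i - y (Suc i)" for i
      using yb[of i] by simp
    then show ?thesis
      unfolding qbinom_def prod_dividef prod.distrib PY_def PB_def PXY_def by simp
  qed
  have gauss: "gauss_binom Q (m + a) m = Q ^ (m * a) * qfact q (m + a) / (qfact q m * qfact q a)"
    using gauss_binom_qfact[OF Q q, of m "m + a"] by simp
  define e e' where "e = - int ((c k)\<^sup>2) + int (c k) + int (\<Sum>i<n. t k i choose 2) + int (\<Sum>j<k. (c (Suc j) - c j) choose 2)"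
    and "e' = - int ((c (Suc k))\<^sup>2) + int (c (Suc k)) + int (\<Sum>i<n. t (Suc k) i choose 2)
      + int (\<Sum>j<Suc k. (c (Suc j) - c j) choose 2)"
  \<comment> \<open>\<open>X\<close> is rewritten by \<open>choose_two_sum\<close>. The mixed terms
    in \<open>m * a\<close> and \<open>x i * b i\<close> then cancel, and what remains is that twice
    \<open>a choose 2\<close> equals \<open>a * (a - 1)\<close>.\<close>
  have e': "e' = e - int (m * a) - int X"
  proof -
    have ch: "int (\<Sum>i<n. y i choose 2) = int (\<Sum>i<n. x i choose 2) + int (\<Sum>i<n. x i * b i) + int (\<Sum>i<n. b i choose 2)"
      unfolding yb choose_two_add sum.distrib of_nat_add ..
    have "a choose 2 = (\<Sum>i\<le>n. b i choose 2) + (\<Sum>i<n. s i * b (Suc i))"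
      using choose_two_sum[of b n] unfolding a_def s_def .
    also have "(\<Sum>i\<le>n. b i choose 2) = (\<Sum>i<n. b i choose 2)"
      unfolding lessThan_Suc_atMost[symmetric] by (simp add: bn)
    finally have a2: "int (\<Sum>i<n. s i * b (Suc i)) = int (a choose 2) - int (\<Sum>i<n. b i choose 2)"
      by simp
    have "(\<Sum>i\<le>n. b i * (m - x i)) = (\<Sum>i<n. b i * (m - x i))"
      unfolding lessThan_Suc_atMost[symmetric] by (simp add: bn)
    also have "int \<dots> = (\<Sum>i<n. int m * int (b i) - int (x i * b i))"
      unfolding of_nat_sum using xm by (intro sum.cong refl) (simp add: of_nat_diff algebra_simps)
    also have "\<dots> = int m * int a - int (\<Sum>i<n. x i * b i)"
      unfolding sum_subtractf a_lt by (simp add: sum_distrib_left)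
    finally have "int X = int m * int a - int (\<Sum>i<n. x i * b i) + int (a choose 2) - int (\<Sum>i<n. b i choose 2)"
      unfolding X_def using a2 by simp
    then show ?thesis
      unfolding e_def e'_def c_Suc m_def[symmetric] x_def[symmetric] y_def[symmetric] ch
      using choose_two_twice[of a]
      by (simp add: c_Suc power2_eq_square algebra_simps flip: m_def)
  qed
  have powers: "Q ^ (m * a) * Q ^ X * q powi e = q powi e'"
  proof -
    have "Q ^ (m * a) * Q ^ X = q powi (- int (m * a + X))"
      unfolding power_add[symmetric] power_int_minus power_int_of_nat q
      by (simp add: power_divide)
    then show ?thesis
      unfolding e' using q_pos by (simp add: algebra_simps flip: power_int_add)
  qed
  \<comment> \<open>\<open>B\<close> leaves out the cells added to row 0, which is why the exponent
    of \<open>1 - q\<close> subtracts the first row.\<close>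
  have "B + b 0 = a"
    unfolding a_def s_lt sum.lessThan_Suc_shift B_def by simp
  then have "m - x 0 + B = c (Suc k) - y 0"
    using yb[of 0] xm[of 0] c_Suc by simp
  then have q_powers: "(1 - q) ^ (m - x 0) * (1 - q) ^ B = (1 - q) ^ (c (Suc k) - y 0)"
    by (simp flip: power_add)
  define Wk where "Wk = (\<Prod>j<k. \<Prod>i<n. qbinom q (t (Suc j) i - t (Suc j) (Suc i)) (t (Suc j) i - t j i))"
  have "flag_count Q c M n (Suc k) =
      Q ^ (m * a) * qfact q (m + a) / (qfact q m * qfact q a) *
      (q powi e * (1 - q) ^ (m - x 0) * qfact q m / PX * Wk *
       (Q ^ X * (1 - q) ^ B * (qfact q a / PB) * (PX / PXY)))"
    unfolding chain gauss chain_count Suc.IH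
    unfolding e_def Wk_def m_def x_def PX_def ..
  \<comment> \<open>Inserting \<open>PY / PY\<close> separates the new denominator from the new
    weight factor; \<open>PX\<close> and the q-factorials of \<open>m\<close> and \<open>a\<close>
    cancel.\<close>
  also have "\<dots> = (Q ^ (m * a) * Q ^ X * q powi e) * ((1 - q) ^ (m - x 0) * (1 - q) ^ B) * qfact q (m + a) / PY
      * (Wk * (PY / (PB * PXY)))"
    using nzs nz by (simp add: mult_ac)
  finally show ?case
    unfolding powers q_powers e'_def c_Suc[symmetric] PY_def y_def[symmetric]
    by (simp add: Wk_def binom[unfolded PY_def] flip: x_def y_def b_def)
qed

section \<open>Tableaux and matrices\<close>

lemma finite_tab_row: "finite {c. (i, c) \<in> young_cells la \<and> T (i, c) \<le> j}"
  by (rule finite_subset[of _ "{..la i}"]) (auto simp: young_cells_def)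

lemma tab_shape_mono: "j \<le> j' \<Longrightarrow> tab_shape T la j i \<le> tab_shape T la j' i"
  unfolding tab_shape_def by (intro card_mono finite_tab_row) auto

lemma tab_shape_0:
  assumes "semistandard T la \<alpha>"
  shows "tab_shape T la 0 i = 0"
proof -
  have "{c. (i, c) \<in> young_cells la \<and> T (i, c) \<le> 0} = {}"
    using assms unfolding semistandard_def by fastforce
  then show ?thesis unfolding tab_shape_def by (simp only: card.empty)
qed

lemma tab_shape_full:
  assumes "semistandard T la \<alpha>" "1 \<le> i"
  shows "tab_shape T la (length \<alpha>) i = la i"
proof -
  have "{c. (i, c) \<in> young_cells la \<and> T (i, c) \<le> length \<alpha>} = {1..la i}"
    using assms unfolding semistandard_def by (auto simp: young_cells_def)
  then show ?thesis unfolding tab_shape_def by simp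
qed

lemma tab_shape_beyond:
  assumes "is_partition la n" "i > n"
  shows "tab_shape T la j i = 0"
  using assms by (simp add: tab_shape_def young_cells_def is_partition_def)

text \<open>Strict increase down the columns makes each \<open>T\<^sup>(\<^sup>j\<^sup>+\<^sup>1\<^sup>)\<close> differ from \<open>T\<^sup>(\<^sup>j\<^sup>)\<close> by a horizontal strip.\<close>

lemma tab_shape_strip:
  assumes "is_partition la n" "semistandard T la \<alpha>" "1 \<le> i"
  shows "tab_shape T la (Suc j) (Suc i) \<le> tab_shape T la j i"
  unfolding tab_shape_def
proof (intro card_mono finite_tab_row subsetI)
  fix c assume c: "c \<in> {c. (Suc i, c) \<in> young_cells la \<and> T (Suc i, c) \<le> Suc j}"
  moreover have "la (Suc i) \<le> la i"
    using assms by (simp add: is_partition_def)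
  ultimately have "(i, c) \<in> young_cells la"
    using assms(3) by (auto simp: young_cells_def)
  moreover have "T (i, c) < T (Suc i, c)"
    using assms(2) c calculation unfolding semistandard_def by blast
  ultimately show "c \<in> {c. (i, c) \<in> young_cells la \<and> T (i, c) \<le> j}"
    using c by auto
qed

lemma sum_tab_shape:
  assumes "is_partition la n"
  shows "(\<Sum>i<n. tab_shape T la j (Suc i)) = card {p \<in> young_cells la. T p \<le> j}"
proof -
  have "{p \<in> young_cells la. T p \<le> j} = (SIGMA i:{1..n}. {c. (i, c) \<in> young_cells la \<and> T (i, c) \<le> j})"
  proof (intro equalityI subsetI)
    fix p assume p: "p \<in> {p \<in> young_cells la. T p \<le> j}"
    obtain i c where ic: "p = (i, c)" by (cases p)
    have "i \<le> n"
      using p ic assms by (rule_tac ccontr) (auto simp: young_cells_def is_partition_def)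
    then show "p \<in> (SIGMA i:{1..n}. {c. (i, c) \<in> young_cells la \<and> T (i, c) \<le> j})"
      using p ic by (auto simp: young_cells_def)
  qed auto
  also have "card \<dots> = (\<Sum>i\<in>{1..n}. tab_shape T la j i)"
    unfolding tab_shape_def by (rule card_SigmaI) (use finite_tab_row in blast)+
  also have "(\<Sum>i\<in>{1..n}. tab_shape T la j i) = (\<Sum>i<n. tab_shape T la j (Suc i))"
    by (rule sum.reindex_bij_witness[of _ Suc "\<lambda>i. i - 1"]) auto
  finally show ?thesis by simp
qed

lemma finite_young_cells:
  assumes "is_partition la n"
  shows "finite (young_cells la)"
proof (rule finite_subset)
  show "young_cells la \<subseteq> (SIGMA i:{..n}. {..la i})"
  proof
    fix p assume p: "p \<in> young_cells la"
    obtain i c where ic: "p = (i, c)" by (cases p)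
    have "i \<le> n"
      using p ic assms by (rule_tac ccontr) (auto simp: young_cells_def is_partition_def)
    then show "p \<in> (SIGMA i:{..n}. {..la i})"
      using p ic by (auto simp: young_cells_def)
  qed
qed auto

text \<open>Raising the bound from \<open>j\<close> to \<open>Suc j\<close> adds exactly the cells
  with entry \<open>Suc j\<close>, whose number the content prescribes. This matches the sizes of
  the shapes with the dimensions in the flag.\<close>

lemma sum_tab_shape_content:
  assumes la: "is_partition la n" and T: "semistandard T la \<alpha>" and j: "j \<le> length \<alpha>"
  shows "(\<Sum>i<n. tab_shape T la j (Suc i)) = sum_list (take j \<alpha>)"
  using j
proof (induction j)
  case 0
  then show ?case by (simp add: tab_shape_0[OF T])
next
  case (Suc j)
  have "{p \<in> young_cells la. T p \<le> Suc j} = {p \<in> young_cells la. T p \<le> j} \<union> {p \<in> young_cells la. T p = Suc j}"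
    by auto
  moreover have "card {p \<in> young_cells la. T p = Suc j} = \<alpha> ! j"
    using T Suc.prems unfolding semistandard_def by force
  ultimately have "card {p \<in> young_cells la. T p \<le> Suc j} = card {p \<in> young_cells la. T p \<le> j} + \<alpha> ! j"
    using finite_young_cells[OF la] by (simp add: card_Un_disjoint disjoint_iff)
  then show ?case
    using Suc by (simp add: sum_tab_shape[OF la] take_Suc_conv_app_nth)
qed

section \<open>Jordan types and kernel dimensions\<close>

lemma kdim_0: "vec.subspace V \<Longrightarrow> kdim f V 0 = 0"
proof -
  assume "vec.subspace V"
  then have "{x \<in> V. x = 0} = {0}"
    by (auto simp: vec.subspace_0)
  then show ?thesis by (simp add: kdim_def)
qed

lemma kdim_mono:
  assumes "f 0 = 0"
  shows "kdim f V j \<le> kdim f V (Suc j)"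
  unfolding kdim_def by (intro vec.dim_subset) (auto simp: assms)

text \<open>The sums telescope, since monotonicity makes the truncated differences exact. This links
  \<open>JF\<close>, defined by differences, with \<open>kdim\<close>.\<close>

lemma increments_iff_partial_sums:
  fixes d \<tau> :: "nat \<Rightarrow> nat"
  assumes "d 0 = 0" "\<And>j. d j \<le> d (Suc j)"
  shows "(\<forall>r\<ge>1. \<tau> r = d r - d (r - 1)) \<longleftrightarrow> (\<forall>j. d j = (\<Sum>i<j. \<tau> (Suc i)))"
proof
  assume a: "\<forall>r\<ge>1. \<tau> r = d r - d (r - 1)"
  show "\<forall>j. d j = (\<Sum>i<j. \<tau> (Suc i))"
  proof
    fix j show "d j = (\<Sum>i<j. \<tau> (Suc i))"
    proof (induction j)
      case (Suc j)
      then show ?case using a[rule_format, of "Suc j"] assms(2)[of j] by simp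
    qed (simp add: assms)
  qed
next
  assume a: "\<forall>j. d j = (\<Sum>i<j. \<tau> (Suc i))"
  show "\<forall>r\<ge>1. \<tau> r = d r - d (r - 1)"
  proof (intro allI impI)
    fix r :: nat assume "1 \<le> r"
    then obtain j where "r = Suc j" by (cases r) auto
    then show "\<tau> r = d r - d (r - 1)"
      using a[rule_format, of j] a[rule_format, of "Suc j"] by simp
  qed
qed

lemma JF_eq_iff:
  assumes "vec.subspace V"
  shows "(\<forall>r\<ge>1. \<tau> r = JF N V r) \<longleftrightarrow> (\<forall>j. kdim ((*v) N) V j = (\<Sum>i<j. \<tau> (Suc i)))"
proof -
  have "(\<forall>r\<ge>1. \<tau> r = JF N V r) \<longleftrightarrow> (\<forall>r\<ge>1. \<tau> r = kdim ((*v) N) V r - kdim ((*v) N) V (r - 1))"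
    by (auto simp: JF_def dimker_def kdim_def)
  also have "\<dots> \<longleftrightarrow> (\<forall>j. kdim ((*v) N) V j = (\<Sum>i<j. \<tau> (Suc i)))"
    by (rule increments_iff_partial_sums) (simp_all add: kdim_0 assms kdim_mono)
  finally show ?thesis .
qed

section \<open>Matrices as linear maps on the whole space\<close>

lemma matrix_Lin_UNIV: "(*v) N \<in> Lin UNIV UNIV"
  by (simp add: Lin_def linear_on_def matrix_vector_right_distrib vector_scalar_commute)

lemma Lin_UNIV_matrix:
  assumes "f \<in> Lin UNIV UNIV"
  shows "(*v) (matrix f) = f"
proof -
  have "Vector_Spaces.linear (*s) (*s) f"
    by unfold_locales (simp_all add: linear_onD[OF LinD(1)[OF assms]])
  then show ?thesis by (auto simp: matrix_works)
qed

lemma flag_maps_matrix_iff: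
  fixes \<alpha> :: "nat list" and F :: "('a::field ^ 'n) set list"
  assumes c: "\<And>i. i \<le> length \<alpha> \<Longrightarrow> c i = sum_list (take i \<alpha>)"
    and M: "\<And>i j. M i j = (\<Sum>r<j. tab_shape T la i (Suc r))"
  shows "flag_of_type \<alpha> F \<and> strictly_compatible N F \<and> JF_flag_eq N F T la \<longleftrightarrow>
    (F, (*v) N) \<in> flag_maps c M (length \<alpha>) UNIV"
proof -
  let ?k = "length \<alpha>"
  have compat: "strictly_compatible N F \<longleftrightarrow> (\<forall>i<?k. (*v) N ` (F ! Suc i) \<subseteq> F ! i)"
    if len: "length F = Suc ?k"
  proof
    assume "strictly_compatible N F"
    then show "\<forall>i<?k. (*v) N ` (F ! Suc i) \<subseteq> F ! i"
      using len unfolding strictly_compatible_def by force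
  next
    assume a: "\<forall>i<?k. (*v) N ` (F ! Suc i) \<subseteq> F ! i"
    show "strictly_compatible N F"
      unfolding strictly_compatible_def
    proof
      fix i assume "i \<in> {1..<length F}"
      then obtain j where "i = Suc j" "j < ?k"
        by (cases i) (auto simp: len)
      then show "(\<lambda>x. N *v x) ` (F ! i) \<subseteq> F ! (i - 1)"
        using a by auto
    qed
  qed
  have jf: "JF_flag_eq N F T la \<longleftrightarrow> (\<forall>i\<le>?k. \<forall>j. kdim ((*v) N) (F ! i) j = M i j)"
    if "length F = Suc ?k" "\<forall>i\<le>?k. vec.subspace (F ! i)"
  proof -
    have "JF_flag_eq N F T la \<longleftrightarrow> (\<forall>i\<le>?k. \<forall>r\<ge>1. tab_shape T la i r = JF N (F ! i) r)"
      unfolding JF_flag_eq_def that(1) by (simp add: less_Suc_eq_le)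
    also have "\<dots> \<longleftrightarrow> (\<forall>i\<le>?k. \<forall>j. kdim ((*v) N) (F ! i) j = M i j)"
      unfolding M using JF_eq_iff[of "F ! i" "tab_shape T la i" N for i] that(2) by blast
    finally show ?thesis .
  qed
  show ?thesis
  \<comment> \<open>Both sides force the length and the subspace property, so outside this case both
    are false.\<close>
  proof (cases "length F = Suc ?k \<and> (\<forall>i\<le>?k. vec.subspace (F ! i))")
    case True
    then show ?thesis
      using compat jf c matrix_Lin_UNIV by (auto simp: flag_of_type_def flag_maps_def)
  next
    case False
    then show ?thesis
      by (auto simp: flag_of_type_def flag_maps_def)
  qed
qed

text \<open>Taking the matrix of a map inverts the passage from \<open>N\<close> to multiplication
  by \<open>N\<close>; on the whole space, extension by zero imposes nothing, so these are ordinary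
  linear maps.\<close>

lemma card_flag_matrices:
  fixes \<alpha> :: "nat list"
  assumes c: "\<And>i. i \<le> length \<alpha> \<Longrightarrow> c i = sum_list (take i \<alpha>)"
    and M: "\<And>i j. M i j = (\<Sum>r<j. tab_shape T la i (Suc r))"
  shows "card {(F, N). flag_of_type \<alpha> (F :: ('a::field ^ 'n) set list)
      \<and> strictly_compatible (N :: 'a ^ 'n ^ 'n) F \<and> JF_flag_eq N F T la} =
    card (flag_maps c M (length \<alpha>) (UNIV :: ('a ^ 'n) set))"
proof (rule bij_betw_same_card)
  have iff: "flag_of_type \<alpha> F \<and> strictly_compatible N F \<and> JF_flag_eq N F T la \<longleftrightarrow>
      (F, (*v) N) \<in> flag_maps c M (length \<alpha>) UNIV" for F and N :: "'a ^ 'n ^ 'n"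
    by (rule flag_maps_matrix_iff[OF c M])
  show "bij_betw (\<lambda>(F, N). (F, (*v) N))
      {(F, N). flag_of_type \<alpha> (F :: ('a::field ^ 'n) set list)
      \<and> strictly_compatible (N :: 'a ^ 'n ^ 'n) F \<and> JF_flag_eq N F T la}
      (flag_maps c M (length \<alpha>) (UNIV :: ('a ^ 'n) set))"
    unfolding iff
  proof (rule bij_betw_byWitness[where f' = "\<lambda>(F, f). (F, matrix f)"])
    have L: "f \<in> Lin UNIV UNIV"
      if "(F, f) \<in> flag_maps c M (length \<alpha>) (UNIV :: ('a ^ 'n) set)" for F f
      using that by (simp add: flag_maps_def)
    show "\<forall>a\<in>flag_maps c M (length \<alpha>) (UNIV :: ('a ^ 'n) set).
        (\<lambda>(F, N). (F, (*v) N)) ((\<lambda>(F, f). (F, matrix f)) a) = a"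
      using Lin_UNIV_matrix[OF L] by auto
    show "(\<lambda>(F, f). (F, matrix f)) ` flag_maps c M (length \<alpha>) (UNIV :: ('a ^ 'n) set)
        \<subseteq> {(F, N). (F, (*v) N) \<in> flag_maps c M (length \<alpha>) UNIV}"
      using Lin_UNIV_matrix[OF L] by auto
  qed auto
qed

section \<open>Translating the count into the statistics of the tableau\<close>

theorem theorem9p6:
  fixes \<alpha> :: "nat list" and la :: "nat \<Rightarrow> nat" and T :: "nat \<times> nat \<Rightarrow> nat"
  assumes "\<exists>p e. prime p \<and> e > 0 \<and> CARD('a::{field,finite}) = p ^ e"
    and "weak_composition \<alpha> CARD('n::finite)"
    and "is_partition la CARD('n)"
    and "semistandard T la \<alpha>"
  shows "let n = CARD('n); q = 1 / real CARD('a) in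
    real (card {(F, N). flag_of_type \<alpha> (F :: ('a ^ 'n) set list) \<and> strictly_compatible (N :: 'a ^ 'n ^ 'n) F
                  \<and> JF_flag_eq N F T la})
    = q powi (- int (n ^ 2) + int n + int (nstat_part la n) + int (nstat_list \<alpha>))
      * (1 - q) ^ (n - la 1) * qfact q n
      / (\<Prod>i\<in>{1..n}. qfact q (la i - la (Suc i)))
      * wt q n T la \<alpha>"
proof -
  note la = assms(3) and T = assms(4)
  define n q K where "n = CARD('n)" and "q = 1 / real CARD('a)" and "K = length \<alpha>"
  \<comment> \<open>Rows of the tableau start at 1, those of \<open>t\<close> at 0.\<close>
  define t where "t j i = tab_shape T la j (Suc i)" for j i
  define c M where "c j = (\<Sum>i<n. t j i)" and "M j i = (\<Sum>r<i. t j r)" for j i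
  have Q: "real CARD('a) > 1"
    using card_scalars_ge_2[where 'a='a] by linarith
  have t_le: "t j i \<le> t (Suc j) i" for j i
    unfolding t_def by (rule tab_shape_mono) simp
  have t_strip: "t (Suc j) (Suc i) \<le> t j i" for j i
    unfolding t_def using tab_shape_strip[OF la T] by simp
  have t_0: "t 0 i = 0" for i
    unfolding t_def using tab_shape_0[OF T] by simp
  have t_n: "t j i = 0" if "i \<ge> n" for j i
    unfolding t_def using tab_shape_beyond[OF la] that by (simp add: n_def)
  have t_K: "t K i = la (Suc i)" for i
    unfolding t_def K_def using tab_shape_full[OF T] by simp
  have c_content: "c i = sum_list (take i \<alpha>)" if "i \<le> K" for i
    unfolding c_def t_def n_def using sum_tab_shape_content[OF la T] that by (simp add: K_def)
  have c_K: "c K = n"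
    using c_content[of K] assms(2) by (simp add: K_def weak_composition_def n_def)
  have reindex: "(\<Sum>i<n. h (Suc i)) = (\<Sum>i\<in>{1..n}. h i)" for h :: "nat \<Rightarrow> nat"
    by (rule sum.reindex_bij_witness[of _ "\<lambda>i. i - 1" Suc]) auto
  have reindex_prod: "(\<Prod>i<m. h (Suc i)) = (\<Prod>i\<in>{1..m}. h i)" for h :: "nat \<Rightarrow> real" and m
    by (rule prod.reindex_bij_witness[of _ "\<lambda>i. i - 1" Suc]) auto
  \<comment> \<open>Rows from \<open>n\<close> on are empty, so \<open>n\<close> serves as the
    common index of stabilisation.\<close>
  have M_n: "M j i = c j" if "i \<ge> n" for j i
    unfolding M_def c_def by (rule sum.mono_neutral_right) (use that t_n in auto)
  have "real (card {(F, N). flag_of_type \<alpha> (F :: ('a ^ 'n) set list)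
      \<and> strictly_compatible (N :: 'a ^ 'n ^ 'n) F \<and> JF_flag_eq N F T la})
    = real (card (flag_maps c M K (UNIV :: ('a ^ 'n) set)))"
    using card_flag_matrices[of \<alpha> c M T la] c_content by (simp add: K_def M_def t_def)
  also have "\<dots> = flag_count (real CARD('a)) c M n K"
  proof (rule card_flag_maps)
    show "vec.dim (UNIV :: ('a ^ 'n) set) = c K"
      by (simp only: c_K n_def vec_dim_card)
    show "M j i \<le> M (Suc j) i" for j i
      unfolding M_def by (intro sum_mono t_le)
    show "M j i = c j" if "i \<ge> n" for j i
      using M_n[OF that] .
  qed (simp_all add: M_def t_0 c_def)
  also have "\<dots> = q powi (- int ((c K)\<^sup>2) + int (c K) + int (\<Sum>i<n. t K i choose 2) + int (\<Sum>j<K. (c (Suc j) - c j) choose 2))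
    * (1 - q) ^ (c K - t K 0) * qfact q (c K) / (\<Prod>i<n. qfact q (t K i - t K (Suc i)))
    * (\<Prod>j<K. \<Prod>i<n. qbinom q (t (Suc j) i - t (Suc j) (Suc i)) (t (Suc j) i - t j i))"
    unfolding c_def M_def
    by (rule flag_count_qfact) (fact Q q_def t_0 t_le t_strip | simp add: t_n)+
  also have "(\<Sum>i<n. t K i choose 2) = nstat_part la n"
    unfolding t_K nstat_part_def by (rule reindex)
  also have "(\<Sum>j<K. (c (Suc j) - c j) choose 2) = nstat_list \<alpha>"
  proof -
    have "c (Suc j) - c j = \<alpha> ! j" if "j < K" for j
      using that c_content[of j] c_content[of "Suc j"] by (simp add: K_def take_Suc_conv_app_nth)
    then have "(\<Sum>j<K. (c (Suc j) - c j) choose 2) = (\<Sum>j<K. \<alpha> ! j choose 2)"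
      by simp
    then show ?thesis
      by (simp add: nstat_list_def K_def sum_list_sum_nth atLeast0LessThan)
  qed
  also have "(\<Prod>i<n. qfact q (t K i - t K (Suc i))) = (\<Prod>i\<in>{1..n}. qfact q (la i - la (Suc i)))"
    unfolding t_K by (rule reindex_prod)
  also have "(\<Prod>j<K. \<Prod>i<n. qbinom q (t (Suc j) i - t (Suc j) (Suc i)) (t (Suc j) i - t j i)) = wt q n T la \<alpha>"
  proof -
    \<comment> \<open>The weight has rows outermost, the induction over the flag has steps
      outermost.\<close>
    have "wt q n T la \<alpha> = (\<Prod>j\<in>{1..K}. \<Prod>i\<in>{1..n}. qbinom q (tab_shape T la j i - tab_shape T la j (Suc i))
        (tab_shape T la j i - tab_shape T la (j - 1) i))"
      unfolding wt_def K_def by (rule prod.swap)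
    then show ?thesis
      unfolding t_def reindex_prod[symmetric] by simp
  qed
  finally show ?thesis
    unfolding Let_def n_def[symmetric] q_def[symmetric] c_K by (simp add: t_K)
qed

end
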